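(* Let $A\in\mathbb{R}^{m\times n}$, $b\in\mathbb{R}^m$ with $b\ne 0$, let $\ell\ge1$ be an integer, and suppose that $q$ steps of Golub-Kahan bidiagonalization of $A$ with initial vector $b$ give matrices $U_{q+1},V_q,\bar C_q,C_q$ with the properties listed in the context. Introduce the functions $$\phi_{q,\ell}(\mu)=\|b\|_2^2\,e_1^*(\mu C_qC_q^*+I)^{-2\ell}e_1,\qquad \bar\phi_{q+1,\ell}(\mu)=\|b\|_2^2\,e_1^*(\mu\bar C_q\bar C_q^*+I)^{-2\ell}e_1 ,$$ and let $$\phi_\ell(\mu)=b^*(\mu AA^*+I)^{-2\ell}b=\int_0^\infty\frac{1}{(\mu t+1)^{2\ell}}\,d\omega(t),$$ with the measure $d\omega$ defined in the context. Then $\phi_{q,\ell}(\mu)$ is a $q$-node Gauss quadrature rule, and $\bar\phi_{q+1,\ell}(\mu)$ is a $(q+1)$-node Gauss-Radau quadrature rule with a fixed node at the origin, for the approximation of the integral $\phi_\ell(\mu)$. Moreover, $$\phi_{q,\ell}(\mu)<\phi_\ell(\mu)<\bar\phi_{q+1,\ell}(\mu),\qquad \mu>0.$$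
   Context: The superscript $^*$ denotes transposition, $I$ is the identity of suitable order, $\|\cdot\|_2$ is the Euclidean norm, and $e_1=[1,0,\ldots,0]^*$ is the first axis vector of appropriate dimension. Golub-Kahan bidiagonalization: $1\le q\ll\min\{m,n\}$ is the number of steps, chosen small enough that the decompositions $$AV_q=U_{q+1}\bar C_q,\qquad A^*U_q=V_qC_q^*$$ exist with the following properties: $U_{q+1}=[u_1,\ldots,u_{q+1}]\in\mathbb{R}^{m\times(q+1)}$ and $V_q=[v_1,\ldots,v_q]\in\mathbb{R}^{n\times q}$ have orthonormal columns, $u_1=b/\|b\|_2$, $U_q$ consists of the first $q$ columns of $U_{q+1}$, and $\bar C_q\in\mathbb{R}^{(q+1)\times q}$ is lower bidiagonal with positive diagonal entries $(\bar C_q)_{j,j}=\rho_j>0$ and positive subdiagonal entries $(\bar C_q)_{j+1,j}=\sigma_{j+1}>0$ for $1\le j\le q$, and all other entries zero. $C_q\in\mathbb{R}^{q\times q}$ consists of the first $q$ rows of $\bar C_q$. Measure: let $AA^*=U\Lambda U^*$ be a spectral factorization with $U$ orthogonal and $\Lambda=\mathrm{diag}[\lambda_1,\ldots,\lambda_m]$, $\lambda_j\ge0$, and let $[\widetilde b_1,\ldots,\widetilde b_m]^*=U^*b$. Then $\omega$ is the nondecreasing piecewise constant distribution function with jumps $\widetilde b_j^2$ at the eigenvalues $\lambda_j$ (jumps at coinciding eigenvalues are added, and a possible jump at $0$ is included in $\int_0^\infty$), so that $\int_0^\infty f(t)\,d\omega(t)=\sum_{j=1}^m f(\lambda_j)\widetilde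 b_j^2=b^*f(AA^* )b$. Quadrature rules: a $q$-node Gauss rule for $d\omega$ is a $q$-node rule that integrates exactly with respect to $d\omega$ all polynomials of degree at most $2q-1$; a $(q+1)$-node Gauss-Radau rule for $d\omega$ with a fixed node at the origin is a rule with $q+1$ nodes, one of which is $0$, that is exact for all polynomials of degree at most $2q$. The rules are applied to the integrand $t\mapsto(\mu t+1)^{-2\ell}$.
   Formalization: The strict upper bound is claimed only if A^*u_{q+1} ≠ σ_{q+1}v_q (otherwise ≤): it fails when the process ends right after q steps, e.g. a_11=a_21=1, all other entries 0, b=e_1, q=1, where φ_ℓ and the Gauss-Radau value coincide for all μ. *)

theory Defs
  imports
    "HOL-Computational_Algebra.Polynomial"
    "HOL-Analysis.Set_Integral"
    "HOL-Analysis.Lebesgue_Measure"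
    "Jordan_Normal_Form.Matrix"
    "Jordan_Normal_Form.Gauss_Jordan_Elimination"
begin

definition norm2 :: "real vec \<Rightarrow> real" where
  "norm2 v = sqrt (v \<bullet> v)"

definition orthonormal_cols :: "real mat \<Rightarrow> bool" where
  "orthonormal_cols M \<longleftrightarrow>
     (\<forall>i < dim_col M. \<forall>j < dim_col M. col M i \<bullet> col M j = (if i = j then 1 else 0))"

definition first_cols :: "nat \<Rightarrow> real mat \<Rightarrow> real mat" where
  "first_cols k M = mat (dim_row M) k (\<lambda>(i, j). M $$ (i, j))"

definition first_rows :: "nat \<Rightarrow> real mat \<Rightarrow> real mat" where
  "first_rows k M = mat k (dim_col M) (\<lambda>(i, j). M $$ (i, j))"

(* M^{-k}; only meaningful when M is square and invertible, since mat_inverse returns None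
   otherwise. *)
definition mat_neg_pow :: "real mat \<Rightarrow> nat \<Rightarrow> real mat" where
  "mat_neg_pow M k = the (mat_inverse M) ^\<^sub>m k"


section \<open>Golub-Kahan bidiagonalization\<close>

(* Indices are 0-based: rho_j sits at position (j - 1, j - 1) and sigma_{j+1} at (j, j - 1). *)
definition lower_bidiagonal_pos :: "nat \<Rightarrow> real mat \<Rightarrow> bool" where
  "lower_bidiagonal_pos q Cbar \<longleftrightarrow>
     Cbar \<in> carrier_mat (q + 1) q \<and>
     (\<forall>j < q. Cbar $$ (j, j) > 0 \<and> Cbar $$ (j + 1, j) > 0) \<and>
     (\<forall>i < q + 1. \<forall>j < q. i \<noteq> j \<and> i \<noteq> j + 1 \<longrightarrow> Cbar $$ (i, j) = 0)"

(* U plays the role of U_{q+1}, V of V_q and Cbar of the (q+1) x q matrix; U_q and C_q are the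
   leading columns of U and the leading rows of Cbar. *)
definition golub_kahan ::
    "real mat \<Rightarrow> real vec \<Rightarrow> nat \<Rightarrow> real mat \<Rightarrow> real mat \<Rightarrow> real mat \<Rightarrow> bool" where
  "golub_kahan A b q U V Cbar \<longleftrightarrow>
     U \<in> carrier_mat (dim_row A) (q + 1) \<and> orthonormal_cols U \<and>
     V \<in> carrier_mat (dim_col A) q \<and> orthonormal_cols V \<and>
     col U 0 = (1 / norm2 b) \<cdot>\<^sub>v b \<and>
     lower_bidiagonal_pos q Cbar \<and>
     A * V = U * Cbar \<and>
     transpose_mat A * first_cols q U = V * transpose_mat (first_rows q Cbar)"

(* The next vector of the recursion is rho_{q+1} v_{q+1} = A^* u_{q+1} - sigma_{q+1} v_q.
   The condition says that it does not vanish, i.e. that the process does not terminate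
   with rho_{q+1} = 0. If it does, then A A^* U_{q+1} = U_{q+1} Cbar Cbar^*, the Gauss-Radau value
   coincides with the integral and the strict upper bound fails. *)
definition no_breakdown ::
    "real mat \<Rightarrow> nat \<Rightarrow> real mat \<Rightarrow> real mat \<Rightarrow> real mat \<Rightarrow> bool" where
  "no_breakdown A q U V Cbar \<longleftrightarrow>
     transpose_mat A *\<^sub>v col U q \<noteq> Cbar $$ (q, q - 1) \<cdot>\<^sub>v col V (q - 1)"


section \<open>The functions of the regularization parameter\<close>

(* v^* (mu B B^* + I)^{-2 l} v *)
definition phi :: "real mat \<Rightarrow> real vec \<Rightarrow> nat \<Rightarrow> real \<Rightarrow> real" where
  "phi B v l \<mu> =
     v \<bullet> (mat_neg_pow (\<mu> \<cdot>\<^sub>m (B * transpose_mat B) + 1\<^sub>m (dim_row B)) (2 * l) *\<^sub>v v)"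

(* With C = C_q this is phi_{q,l}; with C = Cbar it is phi-bar_{q+1,l}. *)
definition phi_proj :: "real mat \<Rightarrow> real vec \<Rightarrow> nat \<Rightarrow> real \<Rightarrow> real" where
  "phi_proj C b l \<mu> = (norm2 b)\<^sup>2 * phi C (unit_vec (dim_row C) 0) l \<mu>"


section \<open>The spectral measure\<close>

(* A A^* = W Lambda W^* with W orthogonal and Lambda = diag (lam 0, ..., lam (m - 1)) >= 0 *)
definition spectral_factorization ::
    "real mat \<Rightarrow> real mat \<Rightarrow> (nat \<Rightarrow> real) \<Rightarrow> bool" where
  "spectral_factorization A W lam \<longleftrightarrow>
     W \<in> carrier_mat (dim_row A) (dim_row A) \<and> orthonormal_cols W \<and>
     (\<forall>j < dim_row A. lam j \<ge> 0) \<and>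
     A * transpose_mat A = W * mat_diag (dim_row A) lam * transpose_mat W"

(* The right-continuous distribution function with jumps (W^* b)_j^2 at lam j. *)
definition spectral_distr :: "real mat \<Rightarrow> (nat \<Rightarrow> real) \<Rightarrow> real vec \<Rightarrow> real \<Rightarrow> real" where
  "spectral_distr W lam b t =
     (\<Sum>j \<in> {j. j < dim_vec b \<and> lam j \<le> t}. ((transpose_mat W *\<^sub>v b) $ j)\<^sup>2)"

definition spectral_measure :: "real mat \<Rightarrow> (nat \<Rightarrow> real) \<Rightarrow> real vec \<Rightarrow> real measure" where
  "spectral_measure W lam b = interval_measure (spectral_distr W lam b)"


section \<open>Quadrature rules\<close>

definition quad_rule ::
    "nat \<Rightarrow> (nat \<Rightarrow> real) \<Rightarrow> (nat \<Rightarrow> real) \<Rightarrow> (real \<Rightarrow> real) \<Rightarrow> real" where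
  "quad_rule k t w f = (\<Sum>i<k. w i * f (t i))"

definition exact_upto ::
    "real measure \<Rightarrow> nat \<Rightarrow> nat \<Rightarrow> (nat \<Rightarrow> real) \<Rightarrow> (nat \<Rightarrow> real) \<Rightarrow> bool" where
  "exact_upto M d k t w \<longleftrightarrow>
     (\<forall>p :: real poly. degree p \<le> d \<longrightarrow>
        set_integrable M {0..} (poly p) \<and>
        (LINT x:{0..}|M. poly p x) = quad_rule k t w (poly p))"

definition gauss_rule ::
    "real measure \<Rightarrow> nat \<Rightarrow> (nat \<Rightarrow> real) \<Rightarrow> (nat \<Rightarrow> real) \<Rightarrow> bool" where
  "gauss_rule M q t w \<longleftrightarrow> inj_on t {..<q} \<and> exact_upto M (2 * q - 1) q t w"

definition gauss_radau_rule ::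
    "real measure \<Rightarrow> nat \<Rightarrow> (nat \<Rightarrow> real) \<Rightarrow> (nat \<Rightarrow> real) \<Rightarrow> bool" where
  "gauss_radau_rule M q t w \<longleftrightarrow>
     inj_on t {..<q + 1} \<and> (\<exists>i < q + 1. t i = 0) \<and> exact_upto M (2 * q) (q + 1) t w"

end

theory Submission
  imports
    Defs
    "HOL-Computational_Algebra.Fundamental_Theorem_Algebra"
    "Jordan_Normal_Form.Determinant"
begin

text \<open>
  The identities \<open>A V = U Cbar\<close> and \<open>A\<^sup>T U\<^sub>q = V C\<^sup>T\<close> intertwine \<open>A A\<^sup>T\<close> with the Jacobi matrices
  \<open>C C\<^sup>T\<close> and \<open>Cbar Cbar\<^sup>T\<close> on the Krylov space of \<open>b\<close>, so the moments of the spectral measure agree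
  with those of the Jacobi matrices up to degree \<open>2q - 1\<close> and \<open>2q\<close> respectively. A Jacobi matrix
  with a Gram factorization has simple nonnegative eigenvalues (the zeros of the orthogonal
  polynomial), which are the nodes; \<open>Cbar Cbar\<^sup>T\<close> is singular, which gives the node \<open>0\<close>.

  For the inequalities no derivatives are needed: with \<open>R\<close> the product of the \<open>x - t\<^sub>i\<close> over the
  (nonzero) nodes, truncating the power series of \<open>1 / R\<^sup>2\<close> or of \<open>1 / (x R\<^sup>2)\<close> in \<open>y = \<mu> x + 1\<close>,
  which has coefficients of one sign, produces a polynomial \<open>h\<close> integrated exactly by the rule and
  agreeing with \<open>y\<^sup>-\<^sup>N\<close> at the nodes, for which \<open>y\<^sup>-\<^sup>N - h\<close> is \<open>R\<^sup>2\<close> or \<open>- x R\<^sup>2\<close> times a positive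
  function. Strictness means that \<open>R\<close> (or \<open>x R\<^sup>2\<close>) does not vanish on the support of the measure.
\<close>

section \<open>Polynomials and the interpolation error\<close>

lemma poly_prod_linear [simp]:
  "poly (\<Prod>i\<in>A. [:- t i, 1:]) x = (\<Prod>i\<in>A. x - (t i :: 'a :: comm_ring_1))"
  by (simp add: poly_prod)

lemma degree_prod_linear [simp]: "degree (\<Prod>i\<in>A. [:- t i, 1 :: 'a :: field:]) = card A"
  by (cases "finite A") (simp_all add: degree_prod_eq_sum_degree)

lemma degree_linear_mult:
  "r \<noteq> 0 \<Longrightarrow> degree ([:a, 1:] * r) = Suc (degree (r :: 'a :: idom poly))"
  by (subst degree_mult_eq) auto

text \<open>Root factors are split off one at a time; distinctness of the points keeps the remaining
  ones roots of the cofactor.\<close>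

lemma prod_linear_dvdI:
  fixes p :: "'a :: field poly"
  assumes "finite A" "inj_on t A" "\<And>i. i \<in> A \<Longrightarrow> poly p (t i) = 0"
  shows "(\<Prod>i\<in>A. [:- t i, 1:]) dvd p"
  using assms
proof (induction A arbitrary: p rule: finite_induct)
  case (insert a A)
  then obtain r where r: "p = [:- t a, 1:] * r"
    by (metis insertI1 poly_eq_0_iff_dvd dvdE)
  have "poly r (t i) = 0" if "i \<in> A" for i
  proof -
    have "t i \<noteq> t a" using inj_on_contraD[OF insert.prems(1), of i a] insert.hyps that by auto
    then show ?thesis using insert.prems(2)[of i] that by (simp add: r)
  qed
  then have "(\<Prod>i\<in>A. [:- t i, 1:]) dvd r"
    using insert by simp
  then show ?case
    unfolding r prod.insert[OF insert.hyps] by (rule mult_dvd_mono[OF dvd_refl])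
qed simp

text \<open>The usual Lagrange basis. The degree bound is guarded because no degree lies below
  \<open>card {} = 0\<close>.\<close>

lemma lagrange_interpolation:
  fixes f :: "'b \<Rightarrow> 'a :: field"
  assumes "finite A" "inj_on t A"
  shows "\<exists>p. (A \<noteq> {} \<longrightarrow> degree p < card A) \<and> (\<forall>i\<in>A. poly p (t i) = f i)"
proof -
  define l where "l i = (\<Prod>j\<in>A - {i}. [:- t j, 1:])" for i
  define p where "p = (\<Sum>i\<in>A. Polynomial.smult (f i / (\<Prod>j\<in>A - {i}. t i - t j)) (l i))"
  have "poly p (t k) = f k" if k: "k \<in> A" for k
  proof -
    have "poly p (t k) = (\<Sum>i\<in>A. if i = k then f k else 0)"
      unfolding p_def poly_sum
    proof (rule sum.cong[OF refl])
      fix i assume i: "i \<in> A"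
      have "(\<Prod>j\<in>A - {k}. t k - t j) \<noteq> 0"
        using assms k by (auto dest: inj_onD)
      moreover have "(\<Prod>j\<in>A - {i}. t k - t j) = 0" if "i \<noteq> k"
        using that k assms(1) by (intro prod_zero) auto
      ultimately show "poly (Polynomial.smult (f i / (\<Prod>j\<in>A - {i}. t i - t j)) (l i)) (t k)
          = (if i = k then f k else 0)"
        by (auto simp: l_def)
    qed
    then show ?thesis using k assms(1) by simp
  qed
  moreover have "degree p < card A" if "A \<noteq> {}"
  proof -
    have "degree p \<le> card A - 1"
      unfolding p_def
      by (intro degree_sum_le[OF assms(1)])
         (use assms in \<open>auto simp: l_def intro!: order.trans[OF degree_smult_le]\<close>)
    moreover have "card A > 0" using that assms(1) by (simp add: card_gt_0_iff)
    ultimately show ?thesis by linarith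
  qed
  ultimately show ?thesis by blast
qed

section \<open>Real, simple roots of orthogonal polynomials\<close>

lemma map_poly_of_real_mult:
  "map_poly complex_of_real (p * q) = map_poly of_real p * map_poly of_real q"
  by (rule poly_eqI) (simp add: coeff_map_poly coeff_mult)

lemma map_poly_of_real_add:
  "map_poly complex_of_real (p + q) = map_poly of_real p + map_poly of_real q"
  by (rule poly_eqI) (simp add: coeff_map_poly)

lemma poly_map_poly_of_real:
  "poly (map_poly complex_of_real p) (of_real x) = of_real (poly p x)"
  by (induction p) (simp_all add: map_poly_pCons)

text \<open>The quadratic is the product of \<open>x - z\<close> and its conjugate. The remainder of
  \<open>p\<close> modulo it is real, of degree at most 1, and vanishes at the nonreal
  \<open>z\<close>, so both its coefficients are zero.\<close>

lemma nonreal_root_quadratic_factor: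
  fixes p :: "real poly"
  assumes z: "poly (map_poly of_real p) z = 0" and "Im z \<noteq> 0"
  shows "[:(Re z)\<^sup>2 + (Im z)\<^sup>2, - 2 * Re z, 1:] dvd p"
proof -
  let ?c = "[:(Re z)\<^sup>2 + (Im z)\<^sup>2, - 2 * Re z, 1:]"
  define m where "m = p mod ?c"
  have "degree m < 2"
    using degree_mod_less'[of ?c p] unfolding m_def
    by (cases "p mod ?c = 0") auto
  then have m: "m = [:coeff m 0, coeff m 1:]"
    by (intro poly_eqI) (auto simp: coeff_pCons coeff_eq_0 split: nat.splits)
  have c: "poly (map_poly of_real ?c) z = 0"
    by (simp add: complex_eq_iff map_poly_pCons algebra_simps power2_eq_square)
  have "p = ?c * (p div ?c) + m" unfolding m_def by (rule mult_div_mod_eq[symmetric])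
  then have "poly (map_poly of_real m) z = 0"
    using z c by (metis map_poly_of_real_add map_poly_of_real_mult poly_add poly_mult
        mult_zero_left add_0)
  then have "of_real (coeff m 0) + z * of_real (coeff m 1) = 0"
    by (subst (asm) m) (simp add: map_poly_pCons)
  then have "coeff m 1 = 0" "coeff m 0 = 0"
    using assms(2) by (auto simp: complex_eq_iff)
  then have "m = 0" by (subst m) simp
  then show ?thesis by (simp add: m_def mod_eq_0_iff_dvd)
qed

text \<open>The classical argument for Gauss nodes: a quadratic factor of an orthogonal polynomial \<open>P\<close>
  that is nonnegative on the real line would make \<open>L (P * r) > 0\<close> for the cofactor \<open>r\<close>.\<close>

lemma orthogonal_poly_splits:
  fixes P :: "real poly" and L :: "real poly \<Rightarrow> real"
  assumes add: "\<And>p r. L (p + r) = L p + L r" and smult: "\<And>c p. L (Polynomial.smult c p) = c * L p"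
    and pos: "\<And>p. p \<noteq> 0 \<Longrightarrow> degree p < degree P \<Longrightarrow> L (p * p) > 0"
    and orth: "\<And>p. degree p < degree P \<Longrightarrow> L (P * p) = 0"
    and monic: "lead_coeff P = 1"
  shows "\<exists>t. inj_on t {..<degree P} \<and> P = (\<Prod>i<degree P. [:- t i, 1:])"
proof -
  have nn: "L (p * p) \<ge> 0" if "degree p < degree P" for p
    using pos[OF _ that] smult[of 0 0] by (cases "p = 0") auto
  have P0: "P \<noteq> 0" using monic by auto
  \<comment> \<open>A double real root is impossible: multiplying \<open>P\<close> by the cofactor
    gives a square, on which \<open>L\<close> is positive, against orthogonality.\<close>
  have no_sq: False if P: "P = [:- a, 1:] * ([:- a, 1:] * r)" for a r
  proof -
    have r0: "r \<noteq> 0" using P0 P by auto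
    then have deg: "degree P = Suc (Suc (degree r))"
      unfolding P by (metis degree_linear_mult degree_0 mult_zero_right nat.distinct(1))
    have "L (P * r) = L (([:- a, 1:] * r) * ([:- a, 1:] * r))"
      unfolding P by (simp only: mult_ac)
    moreover have "L (P * r) = 0" by (rule orth) (simp add: deg)
    moreover have "L (([:- a, 1:] * r) * ([:- a, 1:] * r)) > 0"
      by (rule pos) (use r0 degree_linear_mult[OF r0] in \<open>auto simp: deg simp del: mult_pCons_left\<close>)
    ultimately show False by simp
  qed
  have real_root: "Im z = 0" if z: "poly (map_poly of_real P) z = 0" for z
  proof (rule ccontr)
    assume im: "Im z \<noteq> 0"
    let ?c = "[:(Re z)\<^sup>2 + (Im z)\<^sup>2, - 2 * Re z, 1:]" and ?x = "[:- Re z, 1:]"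
    obtain r where r: "P = ?c * r"
      using nonreal_root_quadratic_factor[OF z im] by (elim dvdE)
    have r0: "r \<noteq> 0" using P0 r by auto
    then have deg: "degree P = Suc (Suc (degree r))"
      unfolding r by (subst degree_mult_eq) auto
    \<comment> \<open>Completing the square writes \<open>P * r\<close> as a nonnegative combination
      of two squares.\<close>
    have c: "?c = ?x * ?x + [:(Im z)\<^sup>2:]" by (simp add: power2_eq_square)
    have "P * r = (?x * r) * (?x * r) + [:(Im z)\<^sup>2:] * (r * r)"
      unfolding r c by (simp only: algebra_simps)
    also have "[:(Im z)\<^sup>2:] * (r * r) = Polynomial.smult ((Im z)\<^sup>2) (r * r)" by simp
    finally have "P * r = (?x * r) * (?x * r) + Polynomial.smult ((Im z)\<^sup>2) (r * r)" .
    then have "L (P * r) = L ((?x * r) * (?x * r)) + (Im z)\<^sup>2 * L (r * r)"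
      by (simp only: add smult)
    moreover have "L (P * r) = 0" by (rule orth) (simp add: deg)
    moreover have "L ((?x * r) * (?x * r)) \<ge> 0"
      by (rule nn) (use degree_linear_mult[OF r0] in \<open>simp add: deg del: mult_pCons_left\<close>)
    moreover have "(Im z)\<^sup>2 * L (r * r) > 0"
      using pos[OF r0] im by (simp add: deg)
    ultimately show False by linarith
  qed
  define Z where "Z = {x. poly P x = 0}"
  have fin: "finite Z" unfolding Z_def by (rule poly_roots_finite[OF P0])
  have "(\<Prod>a\<in>Z. [:- a, 1:]) dvd P"
    by (rule prod_linear_dvdI[OF fin]) (auto simp: Z_def)
  then obtain R where R: "P = (\<Prod>a\<in>Z. [:- a, 1:]) * R" by (rule dvdE)
  \<comment> \<open>A nonconstant cofactor would have a complex root; it is a root of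
    \<open>P\<close>, hence real and already in \<open>Z\<close>, which produces a double
    root.\<close>
  have "degree R = 0"
  proof (rule ccontr)
    assume "degree R \<noteq> 0"
    then have "\<not> constant (poly (map_poly complex_of_real R))"
      by (simp add: constant_degree degree_map_poly)
    then obtain z where z: "poly (map_poly complex_of_real R) z = 0"
      using fundamental_theorem_of_algebra by blast
    then have "poly (map_poly complex_of_real P) z = 0"
      by (subst R) (simp add: map_poly_of_real_mult)
    then have "z = of_real (Re z)" using real_root by (simp add: complex_eq_iff)
    then have "poly R (Re z) = 0"
      using z by (metis poly_map_poly_of_real of_real_eq_0_iff)
    then have "poly P (Re z) = 0" by (subst R) simp
    then have zZ: "Re z \<in> Z" by (simp add: Z_def)
    obtain R' where R': "R = [:- Re z, 1:] * R'"
      using \<open>poly R (Re z) = 0\<close> by (metis poly_eq_0_iff_dvd dvdE)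
    have "P = ([:- Re z, 1:] * (\<Prod>a\<in>Z - {Re z}. [:- a, 1:])) * ([:- Re z, 1:] * R')"
      unfolding R'[symmetric] prod.remove[OF fin zZ, of "\<lambda>a. [:- a, 1:]", symmetric] by (rule R)
    also have "\<dots> = [:- Re z, 1:] * ([:- Re z, 1:] * ((\<Prod>a\<in>Z - {Re z}. [:- a, 1:]) * R'))"
      by (simp only: mult_ac)
    finally have "P = [:- Re z, 1:] * ([:- Re z, 1:] * ((\<Prod>a\<in>Z - {Re z}. [:- a, 1:]) * R'))" .
    then show False by (rule no_sq)
  qed
  moreover have "lead_coeff (\<Prod>a\<in>Z. [:- a, 1:]) = 1"
    unfolding lead_coeff_prod by simp
  then have "lead_coeff R = 1"
    using monic arg_cong[OF R, of lead_coeff] unfolding lead_coeff_mult by simp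
  ultimately have "R = 1" by (metis degree_eq_zeroE lead_coeff_pCons(2) one_pCons)
  with R have PZ: "P = (\<Prod>a\<in>Z. [:- a, 1:])" by simp
  then have "card Z = degree P" by simp
  then obtain t where t: "bij_betw t {..<degree P} Z"
    using fin ex_bij_betw_nat_finite[of Z] by (auto simp: atLeast0LessThan)
  then have "P = (\<Prod>i<degree P. [:- t i, 1:])"
    using PZ prod.reindex_bij_betw[OF t, of "\<lambda>a. [:- a, 1:]"] by simp
  with t show ?thesis by (auto simp: bij_betw_def)
qed

text \<open>\<open>G\<close> is the power series of the reciprocal of the product, cut off below
  order \<open>N\<close>. That series is a product of geometric series with ratios
  \<open>c \<ge> 0\<close>, so its coefficients are nonnegative.\<close>

lemma truncated_inverse:
  fixes cs :: "real list"
  assumes "N > 0" "\<And>c. c \<in> set cs \<Longrightarrow> c \<ge> 0"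
  shows "\<exists>G. degree G < N \<and> coeff G 0 = 1 \<and> (\<forall>i. coeff G i \<ge> 0) \<and>
           monom 1 N dvd 1 - (\<Prod>c\<leftarrow>cs. [:1, - c:]) * G"
  using assms(2)
proof (induction cs)
  case Nil
  then show ?case using assms(1) by (intro exI[of _ 1]) (auto simp: coeff_1)
next
  case (Cons c cs)
  define S where "S = (\<Prod>c\<leftarrow>cs. [:1, - c:])"
  from Cons obtain G where G: "degree G < N" "coeff G 0 = 1" "\<And>i. coeff G i \<ge> 0"
      "monom 1 N dvd 1 - S * G"
    unfolding S_def by auto
  \<comment> \<open>The truncated geometric series, an inverse of \<open>1 - c * y\<close> modulo
    \<open>y ^ N\<close>.\<close>
  define E where "E = (\<Sum>k<N. monom (c ^ k) k)"
  have E: "coeff E i = (if i < N then c ^ i else 0)" for i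
    by (simp add: E_def coeff_sum)
  have cE: "monom 1 N dvd 1 - [:1, - c:] * E"
    unfolding monom_1_dvd_iff' by (auto simp: E coeff_pCons split: nat.splits)
  define G' where "G' = poly_cutoff N (G * E)"
  have G'_c: "coeff G' i = (if i < N then coeff (G * E) i else 0)" for i
    by (simp add: G'_def coeff_poly_cutoff)
  have GE: "monom 1 N dvd G * E - G'"
    unfolding monom_1_dvd_iff' by (auto simp: G'_c)
  \<comment> \<open>Three sources of error: the old inverse, the geometric series and the cutoff.
    Each is divisible by \<open>y ^ N\<close>.\<close>
  have "1 - ([:1, - c:] * S) * G'
      = (1 - S * G) + S * G * (1 - [:1, - c:] * E) + [:1, - c:] * S * (G * E - G')"
    by (simp only: algebra_simps)
  then have "monom 1 N dvd 1 - ([:1, - c:] * S) * G'"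
    using G(4) cE GE by (simp only: dvd_add dvd_mult)
  moreover have "coeff G' i \<ge> 0" for i
    using G(3) Cons.prems by (auto simp: G'_c coeff_mult E intro!: sum_nonneg)
  moreover have "coeff G' 0 = 1" using assms(1) G(2) by (simp add: G'_c coeff_mult E)
  moreover have "degree G' < N"
  proof -
    have "degree G' \<le> N - 1" by (rule degree_le) (auto simp: G'_c)
    with assms(1) show ?thesis by linarith
  qed
  ultimately show ?case
    by (intro exI[of _ G']) (auto simp: S_def)
qed

text \<open>Interpolating \<open>1 / y ^ N\<close> at the points \<open>1 / c\<close> (with multiplicity) leaves an error with an
  explicit sign, because the truncated power series of \<open>1 / (\<Prod>c. 1 - c * y)\<close> has nonnegative
  coefficients. This replaces the derivative in the Hermite interpolation error.\<close>

lemma inverse_power_interpolation: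
  fixes cs :: "real list"
  assumes N: "N > 0" and c: "\<And>c. c \<in> set cs \<Longrightarrow> c \<ge> 0"
  shows "\<exists>h G. degree h \<le> length cs - 1 \<and>
     (\<forall>y>0. poly G y > 0 \<and> 1 / y ^ N - poly h y = (\<Prod>c\<leftarrow>cs. 1 - c * y) * (poly G y / y ^ N))"
proof -
  let ?S = "\<Prod>c\<leftarrow>cs. [:1, - c:]"
  obtain G where G: "degree G < N" "coeff G 0 = 1" "\<And>i. coeff G i \<ge> 0"
      "monom 1 N dvd 1 - ?S * G"
    using truncated_inverse[OF assms] by blast
  \<comment> \<open>Dividing this identity by \<open>y ^ N\<close> makes \<open>h\<close> the
    interpolant and \<open>?S * G / y ^ N\<close> its error.\<close>
  obtain h where h: "1 - ?S * G = monom 1 N * h" using G(4) by (elim dvdE)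
  have S: "poly ?S y = (\<Prod>c\<leftarrow>cs. 1 - c * y)" for y
    by (induction cs) (simp_all add: algebra_simps)
  have "degree ?S \<le> length cs"
  proof (induction cs)
    case (Cons a cs)
    have "degree [:1, - a:] \<le> 1" by simp
    with Cons show ?case
      using degree_mult_le[of "[:1, - a:]" "\<Prod>c\<leftarrow>cs. [:1, - c:]"] by simp
  qed simp
  then have "degree (?S * G) \<le> length cs + N - 1"
    using degree_mult_le[of ?S G] G(1) by linarith
  then have le: "degree (1 - ?S * G) \<le> length cs + N - 1"
    by (intro degree_diff_le) auto
  have "degree h \<le> length cs - 1"
  proof (cases "h = 0")
    case False
    then have "degree (1 - ?S * G) = N + degree h"
      unfolding h by (subst degree_mult_eq) (auto simp: degree_monom_eq)
    with le show ?thesis by linarith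
  qed simp
  moreover have "poly G y > 0 \<and>
      1 / y ^ N - poly h y = (\<Prod>c\<leftarrow>cs. 1 - c * y) * (poly G y / y ^ N)" if y: "y > 0" for y
  proof
    \<comment> \<open>The constant term 1 bounds \<open>G\<close> from below, since all other terms
      are nonnegative for \<open>y > 0\<close>.\<close>
    have "0 < coeff G 0 * y ^ 0" using G(2) by simp
    also have "\<dots> \<le> (\<Sum>i\<le>degree G. coeff G i * y ^ i)"
      by (rule member_le_sum) (use G(3) y in auto)
    finally show "poly G y > 0" by (simp add: poly_altdef)
    have "poly (1 - ?S * G) y = poly (monom 1 N * h) y" by (simp only: h)
    then show "1 / y ^ N - poly h y = (\<Prod>c\<leftarrow>cs. 1 - c * y) * (poly G y / y ^ N)"
      using y by (simp add: S poly_monom field_simps)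
  qed
  ultimately show ?thesis by blast
qed

text \<open>Under \<open>y = \<mu> * x + 1\<close> the factor \<open>1 - y / y_i\<close> is a
  constant multiple of \<open>x - t i\<close>, so the product becomes the nodal polynomial up to a
  constant.\<close>

lemma prod_linear_rescale:
  fixes t :: "nat \<Rightarrow> real"
  assumes "\<mu> > 0" "\<And>i. i < q \<Longrightarrow> t i \<ge> 0"
  shows "(\<Prod>c\<leftarrow>map (\<lambda>i. 1 / (\<mu> * t i + 1)) [0..<q]. 1 - c * (\<mu> * x + 1))
       = (\<Prod>i<q. - \<mu> / (\<mu> * t i + 1)) * (\<Prod>i<q. x - t i)"
proof -
  have "(\<Prod>c\<leftarrow>map (\<lambda>i. 1 / (\<mu> * t i + 1)) [0..<q]. 1 - c * (\<mu> * x + 1))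
      = (\<Prod>i<q. 1 - 1 / (\<mu> * t i + 1) * (\<mu> * x + 1))"
    by (induction q) (simp_all add: mult.commute)
  also have "\<dots> = (\<Prod>i<q. - \<mu> / (\<mu> * t i + 1) * (x - t i))"
  proof (rule prod.cong[OF refl])
    fix i assume "i \<in> {..<q}"
    then have "\<mu> * t i + 1 > 0" using assms by (simp add: add_nonneg_pos)
    then show "1 - 1 / (\<mu> * t i + 1) * (\<mu> * x + 1) = - \<mu> / (\<mu> * t i + 1) * (x - t i)"
      by (simp add: field_simps)
  qed
  finally show ?thesis by (simp only: prod.distrib)
qed

text \<open>Each node enters the interpolation twice, so the nodal polynomial and the rescaling
  constant appear squared. Altogether \<open>2 * q\<close> points give degree at most
  \<open>2 * q - 1\<close>.\<close>

lemma gauss_error: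
  fixes t :: "nat \<Rightarrow> real"
  assumes \<mu>: "\<mu> > 0" and N: "N > 0" and t: "\<And>i. i < q \<Longrightarrow> t i \<ge> 0"
  shows "\<exists>h d. degree h \<le> 2 * q - 1 \<and> (\<forall>x\<ge>0. d x > 0 \<and>
     1 / (\<mu> * x + 1) ^ N - poly h x = (\<Prod>i<q. x - t i)\<^sup>2 * d x)"
proof -
  define cs where "cs = map (\<lambda>i. 1 / (\<mu> * t i + 1)) [0..<q]"
  define k where "k = (\<Prod>i<q. - \<mu> / (\<mu> * t i + 1))"
  have ge: "\<mu> * x + 1 > 0" if "x \<ge> 0" for x using \<mu> that by (simp add: add_nonneg_pos)
  have k: "k \<noteq> 0" using \<mu> ge t unfolding k_def by (force simp: less_le)
  have "c \<ge> 0" if "c \<in> set (cs @ cs)" for c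
    using that ge t by (auto simp: cs_def less_imp_le)
  from inverse_power_interpolation[OF N this] obtain h G where
    h: "degree h \<le> length (cs @ cs) - 1" and
    G: "\<And>y. y > 0 \<Longrightarrow> poly G y > 0 \<and>
      1 / y ^ N - poly h y = (\<Prod>c\<leftarrow>cs @ cs. 1 - c * y) * (poly G y / y ^ N)" by blast
  have S: "(\<Prod>c\<leftarrow>cs. 1 - c * (\<mu> * x + 1)) = k * (\<Prod>i<q. x - t i)" for x
    unfolding cs_def k_def by (rule prod_linear_rescale[OF \<mu> t])
  show ?thesis
  proof (intro exI conjI allI impI)
    show "degree (pcompose h [:1, \<mu>:]) \<le> 2 * q - 1"
      using h \<mu> by (simp add: degree_pcompose cs_def)
    fix x :: real assume "x \<ge> 0"
    note y = ge[OF this] and G = G[OF ge[OF this]]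
    show "k\<^sup>2 * (poly G (\<mu> * x + 1) / (\<mu> * x + 1) ^ N) > 0"
      using G k y by simp
    show "1 / (\<mu> * x + 1) ^ N - poly (pcompose h [:1, \<mu>:]) x
        = (\<Prod>i<q. x - t i)\<^sup>2 * (k\<^sup>2 * (poly G (\<mu> * x + 1) / (\<mu> * x + 1) ^ N))"
      using G S[of x] by (simp add: poly_pcompose power2_eq_square mult_ac add_ac)
  qed
qed

text \<open>The extra entry \<open>c = 1\<close> is the simple node \<open>x = 0\<close>. Its factor
  \<open>1 - y = - \<mu> * x\<close> flips the sign of the error, and \<open>2 * q + 1\<close>
  points give degree at most \<open>2 * q\<close>.\<close>

lemma radau_error:
  fixes t :: "nat \<Rightarrow> real"
  assumes \<mu>: "\<mu> > 0" and N: "N > 0" and t: "\<And>i. i < q \<Longrightarrow> t i \<ge> 0"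
  shows "\<exists>h d. degree h \<le> 2 * q \<and> (\<forall>x\<ge>0. d x > 0 \<and>
     poly h x - 1 / (\<mu> * x + 1) ^ N = x * (\<Prod>i<q. x - t i)\<^sup>2 * d x)"
proof -
  define cs where "cs = map (\<lambda>i. 1 / (\<mu> * t i + 1)) [0..<q]"
  define k where "k = (\<Prod>i<q. - \<mu> / (\<mu> * t i + 1))"
  have ge: "\<mu> * x + 1 > 0" if "x \<ge> 0" for x using \<mu> that by (simp add: add_nonneg_pos)
  have k: "k \<noteq> 0" using \<mu> ge t unfolding k_def by (force simp: less_le)
  have "c \<ge> 0" if "c \<in> set (1 # cs @ cs)" for c
    using that ge t by (auto simp: cs_def less_imp_le)
  from inverse_power_interpolation[OF N this] obtain h G where
    h: "degree h \<le> length (1 # cs @ cs) - 1" and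
    G: "\<And>y. y > 0 \<Longrightarrow> poly G y > 0 \<and>
      1 / y ^ N - poly h y = (\<Prod>c\<leftarrow>1 # cs @ cs. 1 - c * y) * (poly G y / y ^ N)" by blast
  have S: "(\<Prod>c\<leftarrow>cs. 1 - c * (\<mu> * x + 1)) = k * (\<Prod>i<q. x - t i)" for x
    unfolding cs_def k_def by (rule prod_linear_rescale[OF \<mu> t])
  show ?thesis
  proof (intro exI conjI allI impI)
    show "degree (pcompose h [:1, \<mu>:]) \<le> 2 * q"
      using h \<mu> by (simp add: degree_pcompose cs_def)
    fix x :: real assume "x \<ge> 0"
    note y = ge[OF this] and G = G[OF ge[OF this]]
    show "\<mu> * k\<^sup>2 * (poly G (\<mu> * x + 1) / (\<mu> * x + 1) ^ N) > 0"
      using G k y \<mu> by simp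
    have "1 / (\<mu> * x + 1) ^ N - poly (pcompose h [:1, \<mu>:]) x
        = - (x * (\<Prod>i<q. x - t i)\<^sup>2 * (\<mu> * k\<^sup>2 * (poly G (\<mu> * x + 1) / (\<mu> * x + 1) ^ N)))"
      using G S[of x] by (simp add: poly_pcompose power2_eq_square mult_ac add_ac)
    then show "poly (pcompose h [:1, \<mu>:]) x - 1 / (\<mu> * x + 1) ^ N
        = x * (\<Prod>i<q. x - t i)\<^sup>2 * (\<mu> * k\<^sup>2 * (poly G (\<mu> * x + 1) / (\<mu> * x + 1) ^ N))"
      by linarith
  qed
qed

section \<open>Polynomials in a matrix\<close>

lemma mult_mat_zero_vec [simp]: "A \<in> carrier_mat nr nc \<Longrightarrow> A *\<^sub>v 0\<^sub>v nc = 0\<^sub>v nr"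
  by (intro eq_vecI) auto

lemma zero_smult_vec [simp]: "v \<in> carrier_vec n \<Longrightarrow> (0 :: 'a :: semiring_0) \<cdot>\<^sub>v v = 0\<^sub>v n"
  by (intro eq_vecI) auto

lemma smult_mat_mult_vec:
  "A \<in> carrier_mat nr nc \<Longrightarrow> v \<in> carrier_vec nc \<Longrightarrow>
     (c \<cdot>\<^sub>m A) *\<^sub>v v = c \<cdot>\<^sub>v (A *\<^sub>v (v :: 'a :: comm_semiring_0 vec))"
  by (intro eq_vecI) (auto simp: scalar_prod_def sum_distrib_left mult_ac)

lemma scalar_prod_self_nonneg: "(v :: real vec) \<bullet> v \<ge> 0"
  by (simp add: scalar_prod_def sum_nonneg)

lemma scalar_prod_self_eq_0_iff:
  "(v :: real vec) \<in> carrier_vec n \<Longrightarrow> v \<bullet> v = 0 \<longleftrightarrow> v = 0\<^sub>v n"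
  by (auto simp: scalar_prod_def sum_nonneg_eq_0_iff intro!: eq_vecI)

lemma scalar_prod_self_pos:
  "(v :: real vec) \<in> carrier_vec n \<Longrightarrow> v \<noteq> 0\<^sub>v n \<Longrightarrow> v \<bullet> v > 0"
  using scalar_prod_self_nonneg[of v] scalar_prod_self_eq_0_iff[of v n] by linarith

lemma scalar_prod_mult_mat_vec:
  fixes A :: "real mat"
  assumes "A \<in> carrier_mat nr nc" "x \<in> carrier_vec nr" "y \<in> carrier_vec nc"
  shows "x \<bullet> (A *\<^sub>v y) = (transpose_mat A *\<^sub>v x) \<bullet> y"
proof -
  have "x \<bullet> (A *\<^sub>v y) = (A *\<^sub>v y) \<bullet> x"
    using assms by (intro comm_scalar_prod[of _ nr]) auto
  also have "\<dots> = y \<bullet> (transpose_mat A *\<^sub>v x)"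
    using assms transpose_vec_mult_scalar[of "transpose_mat A" nc nr x y] by simp
  also have "\<dots> = (transpose_mat A *\<^sub>v x) \<bullet> y"
    using assms by (intro comm_scalar_prod[of _ nc]) auto
  finally show ?thesis .
qed

lemma scalar_prod_gram:
  fixes B :: "real mat"
  assumes "B \<in> carrier_mat r s" "x \<in> carrier_vec r" "y \<in> carrier_vec r"
  shows "x \<bullet> ((B * transpose_mat B) *\<^sub>v y) = (transpose_mat B *\<^sub>v x) \<bullet> (transpose_mat B *\<^sub>v y)"
  using assms by (simp add: scalar_prod_mult_mat_vec[of B r s])

text \<open>Horner's scheme for \<open>p(M) v\<close>: only matrix-vector products occur, and no
  powers of \<open>M\<close> are formed.\<close>

definition poly_op :: "'a :: field mat \<Rightarrow> 'a poly \<Rightarrow> 'a vec \<Rightarrow> 'a vec" where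
  "poly_op M p v = fold_coeffs (\<lambda>a w. a \<cdot>\<^sub>v v + M *\<^sub>v w) p (0\<^sub>v (dim_vec v))"

context
  fixes M :: "'a :: field mat" and n :: nat
  assumes M: "M \<in> carrier_mat n n"
begin

lemma poly_op_0 [simp]: "v \<in> carrier_vec n \<Longrightarrow> poly_op M 0 v = 0\<^sub>v n"
  by (simp add: poly_op_def)

lemma poly_op_pCons [simp]:
  "v \<in> carrier_vec n \<Longrightarrow> poly_op M (pCons a p) v = a \<cdot>\<^sub>v v + M *\<^sub>v poly_op M p v"
  using M by (cases "p = 0 \<and> a = 0") (auto simp: poly_op_def)

lemma poly_op_carrier [simp]: "v \<in> carrier_vec n \<Longrightarrow> poly_op M p v \<in> carrier_vec n"
  using M by (induction p) auto

lemma poly_op_add: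
  assumes v: "v \<in> carrier_vec n"
  shows "poly_op M (p + r) v = poly_op M p v + poly_op M r v"
proof (induction p r rule: poly_induct2)
  case (pCons a p b r)
  have "poly_op M p v \<in> carrier_vec n" "poly_op M r v \<in> carrier_vec n" using v by auto
  then show ?case
    using pCons M v by (auto simp: mult_add_distrib_mat_vec[OF M] add_smult_distrib_vec intro!: eq_vecI)
qed (use v in auto)

lemma poly_op_smult:
  assumes v: "v \<in> carrier_vec n"
  shows "poly_op M (Polynomial.smult c p) v = c \<cdot>\<^sub>v poly_op M p v"
proof (induction p)
  case (pCons a p)
  have "poly_op M p v \<in> carrier_vec n" using v by auto
  then show ?case
    using pCons M v
    by (auto simp: mult_mat_vec[OF M] smult_add_distrib_vec[of _ n] smult_smult_assoc intro!: eq_vecI)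
qed (use v in auto)

lemma poly_op_1 [simp]: "v \<in> carrier_vec n \<Longrightarrow> poly_op M 1 v = v"
  using M by (simp add: one_pCons)

lemma poly_op_mult:
  assumes v: "v \<in> carrier_vec n"
  shows "poly_op M (p * r) v = poly_op M p (poly_op M r v)"
  by (induction p) (use v M in \<open>simp_all add: poly_op_add poly_op_smult zero_smult_vec[OF v]\<close>)

lemma poly_op_diff:
  assumes v: "v \<in> carrier_vec n"
  shows "poly_op M (p - r) v = poly_op M p v - poly_op M r v"
proof -
  have "poly_op M (p - r) v = poly_op M (p + Polynomial.smult (-1) r) v" by simp
  also have "\<dots> = poly_op M p v + (-1) \<cdot>\<^sub>v poly_op M r v"
    unfolding poly_op_add[OF v] poly_op_smult[OF v] ..
  also have "\<dots> = poly_op M p v - poly_op M r v"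
    using poly_op_carrier[OF v, of p] poly_op_carrier[OF v, of r] by (intro eq_vecI) auto
  finally show ?thesis .
qed

text \<open>Scaling by \<open>c\<close> is the action of a constant polynomial, and polynomials in
  \<open>M\<close> commute.\<close>

lemma poly_op_smult_vec:
  assumes v: "v \<in> carrier_vec n"
  shows "poly_op M p (c \<cdot>\<^sub>v v) = c \<cdot>\<^sub>v poly_op M p v"
proof -
  have "poly_op M p (poly_op M [:c:] v) = poly_op M [:c:] (poly_op M p v)"
    by (simp only: poly_op_mult[OF v, symmetric] mult.commute)
  then show ?thesis using v M by simp
qed

lemma poly_op_mult_mat_vec:
  assumes v: "v \<in> carrier_vec n"
  shows "poly_op M p (M *\<^sub>v v) = M *\<^sub>v poly_op M p v"
proof -
  have "poly_op M p (poly_op M [:0, 1:] v) = poly_op M [:0, 1:] (poly_op M p v)"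
    by (simp only: poly_op_mult[OF v, symmetric] mult.commute)
  moreover have "poly_op M [:0, 1:] w = M *\<^sub>v w" if "w \<in> carrier_vec n" for w
    using that M by simp
  ultimately show ?thesis using v poly_op_carrier[OF v, of p] by metis
qed

lemma poly_op_zero_vec [simp]: "poly_op M p (0\<^sub>v n) = 0\<^sub>v n"
  using M by (induction p) auto

end

text \<open>One factor \<open>M\<close> is moved across the inner product at a time. The induction
  generalizes \<open>y\<close> because it is applied to \<open>M *\<^sub>v y\<close>.\<close>

lemma poly_op_symmetric:
  fixes M :: "real mat"
  assumes M: "M \<in> carrier_mat n n" and sym: "transpose_mat M = M"
    and x: "x \<in> carrier_vec n" and y: "y \<in> carrier_vec n"
  shows "x \<bullet> poly_op M p y = poly_op M p x \<bullet> y"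
  using y
proof (induction p arbitrary: y)
  case (pCons a p)
  note c = poly_op_carrier[OF M]
  have "x \<bullet> poly_op M (pCons a p) y = a * (x \<bullet> y) + x \<bullet> (M *\<^sub>v poly_op M p y)"
    using x pCons.prems M c by (simp add: scalar_prod_add_distrib[of _ n] poly_op_pCons[OF M])
  also have "x \<bullet> (M *\<^sub>v poly_op M p y) = x \<bullet> poly_op M p (M *\<^sub>v y)"
    using pCons.prems by (simp add: poly_op_mult_mat_vec[OF M])
  also have "\<dots> = poly_op M p x \<bullet> (M *\<^sub>v y)"
    using pCons M by simp
  also have "\<dots> = (M *\<^sub>v poly_op M p x) \<bullet> y"
    using scalar_prod_mult_mat_vec[OF M, of "poly_op M p x" y] x pCons.prems c sym by simp
  also have "a * (x \<bullet> y) + (M *\<^sub>v poly_op M p x) \<bullet> y = poly_op M (pCons a p) x \<bullet> y"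
    using x pCons.prems M c by (simp add: add_scalar_prod_distrib[of _ n] poly_op_pCons[OF M])
  finally show ?case .
qed (use x poly_op_0[OF M] in simp)

text \<open>A linear functional is determined by its moments, so agreement of two functionals up to
  degree \<open>d\<close> only has to be checked on monomials.\<close>

lemma poly_functional_eq_sum:
  fixes L :: "'a :: comm_ring_1 poly \<Rightarrow> 'a"
  assumes add: "\<And>p r. L (p + r) = L p + L r" and smult: "\<And>c p. L (Polynomial.smult c p) = c * L p"
  shows "degree p \<le> d \<Longrightarrow> L p = (\<Sum>k\<le>d. coeff p k * L (monom 1 k))"
proof -
  have sum: "L (\<Sum>k\<in>K. f k) = (\<Sum>k\<in>K. L (f k))" if "finite K" for f and K :: "nat set"
    using that
  proof (induction K rule: finite_induct)
    case empty
    show ?case using smult[of 0 0] by simp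
  qed (simp add: add)
  assume "degree p \<le> d"
  then have "L p = L (\<Sum>k\<le>d. monom (coeff p k) k)" by (simp add: poly_as_sum_of_monoms')
  also have "\<dots> = (\<Sum>k\<le>d. L (Polynomial.smult (coeff p k) (monom 1 k)))"
    by (simp add: sum smult_monom)
  finally show ?thesis by (simp only: smult)
qed

lemma poly_moment:
  fixes M :: "real mat"
  assumes M: "M \<in> carrier_mat n n" and x: "x \<in> carrier_vec n" and y: "y \<in> carrier_vec n"
  shows "degree p \<le> d \<Longrightarrow> x \<bullet> poly_op M p y = (\<Sum>k\<le>d. coeff p k * (x \<bullet> poly_op M (monom 1 k) y))"
proof (rule poly_functional_eq_sum)
  note c = poly_op_carrier[OF M y]
  show "x \<bullet> poly_op M (p + r) y = x \<bullet> poly_op M p y + x \<bullet> poly_op M r y" for p r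
    using x c by (simp add: poly_op_add[OF M y] scalar_prod_add_distrib[of _ n])
  show "x \<bullet> poly_op M (Polynomial.smult a p) y = a * (x \<bullet> poly_op M p y)" for a p
    using x c by (simp add: poly_op_smult[OF M y])
qed

text \<open>The quadratic form of \<open>K\<close> at \<open>v\<close> is \<open>\<mu>\<close> times
  the squared norm of \<open>transpose_mat B *\<^sub>v v\<close> plus that of \<open>v\<close>, so
  the kernel is trivial. This makes \<open>mat_neg_pow K\<close> a genuine inverse power.\<close>

lemma gram_shift_inverse:
  fixes B :: "real mat"
  assumes B: "B \<in> carrier_mat r s" and \<mu>: "\<mu> \<ge> 0"
  defines "K \<equiv> \<mu> \<cdot>\<^sub>m (B * transpose_mat B) + 1\<^sub>m r"
  shows "\<exists>K'. mat_inverse K = Some K' \<and> K' \<in> carrier_mat r r \<and> K' * K = 1\<^sub>m r"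
proof -
  have K: "K \<in> carrier_mat r r" using B unfolding K_def by auto
  have "det K \<noteq> 0"
  proof
    assume "det K = 0"
    then obtain v where v: "v \<in> carrier_vec r" "v \<noteq> 0\<^sub>v r" "K *\<^sub>v v = 0\<^sub>v r"
      using det_0_iff_vec_prod_zero_field[OF K] by blast
    define G where "G = B * transpose_mat B"
    have G: "G \<in> carrier_mat r r" using B unfolding G_def by auto
    have "K *\<^sub>v v = \<mu> \<cdot>\<^sub>v (G *\<^sub>v v) + v"
      using v G unfolding K_def G_def[symmetric]
      by (simp add: add_mult_distrib_mat_vec[of _ r r] smult_mat_mult_vec[of _ r r])
    then have "0 = v \<bullet> (\<mu> \<cdot>\<^sub>v (G *\<^sub>v v) + v)"
      using v(3) scalar_prod_right_zero[OF v(1)] by simp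
    also have "\<dots> = \<mu> * (v \<bullet> (G *\<^sub>v v)) + v \<bullet> v"
      using v G by (simp add: scalar_prod_add_distrib[of _ r])
    also have "v \<bullet> (G *\<^sub>v v) \<ge> 0"
      unfolding G_def using scalar_prod_gram[OF B v(1) v(1)] scalar_prod_self_nonneg by simp
    then have "\<mu> * (v \<bullet> (G *\<^sub>v v)) + v \<bullet> v > 0"
      using \<mu> scalar_prod_self_pos[OF v(1,2)] by (simp add: add_nonneg_pos)
    finally show False by simp
  qed
  then have "mat_inverse K \<noteq> None"
    using mat_inverse(1)[OF K, where b = "()"] det_non_zero_imp_unit[OF K, where b = "()"] by blast
  then show ?thesis using mat_inverse(2)[OF K] by blast
qed

text \<open>Removes the inverse from \<open>phi\<close>: it suffices to exhibit a solution
  \<open>x\<close> of the linear system with matrix \<open>(\<mu> B B^T + I)^(2 l)\<close> and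
  right-hand side \<open>v\<close>.\<close>

lemma phi_eqI:
  assumes B: "B \<in> carrier_mat r s" and \<mu>: "\<mu> \<ge> 0"
    and x: "x \<in> carrier_vec r"
    and v: "poly_op (B * transpose_mat B) ([:1, \<mu>:] ^ (2 * l)) x = v"
  shows "phi B v l \<mu> = v \<bullet> x"
proof -
  define G where "G = B * transpose_mat B"
  define K where "K = \<mu> \<cdot>\<^sub>m G + 1\<^sub>m r"
  have G: "G \<in> carrier_mat r r" using B unfolding G_def by auto
  then have K: "K \<in> carrier_mat r r" unfolding K_def by auto
  obtain K' where K': "mat_inverse K = Some K'" "K' \<in> carrier_mat r r" "K' * K = 1\<^sub>m r"
    using gram_shift_inverse[OF B \<mu>] unfolding K_def G_def by blast
  have lin: "poly_op G [:1, \<mu>:] w = K *\<^sub>v w" if "w \<in> carrier_vec r" for w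
    using that G unfolding K_def
    by (simp add: poly_op_pCons[OF G] poly_op_0[OF G] mult_mat_vec[OF G] mult_mat_zero_vec[OF G]
          add_mult_distrib_mat_vec[of _ r r] smult_mat_mult_vec[of _ r r] comm_add_vec[of w r])
  \<comment> \<open>The innermost inverse meets the outermost factor \<open>K\<close>, so the
    factors cancel in pairs.\<close>
  have "K' ^\<^sub>m k *\<^sub>v poly_op G ([:1, \<mu>:] ^ k) x = x" for k
  proof (induction k)
    case 0
    then show ?case using x G K' by (simp add: poly_op_1[OF G])
  next
    case (Suc k)
    let ?w = "poly_op G ([:1, \<mu>:] ^ k) x"
    have w: "?w \<in> carrier_vec r" using poly_op_carrier[OF G x] .
    have "K' ^\<^sub>m Suc k *\<^sub>v poly_op G ([:1, \<mu>:] ^ Suc k) x = K' ^\<^sub>m k *\<^sub>v (K' *\<^sub>v (K *\<^sub>v ?w))"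
      unfolding power_Suc poly_op_mult[OF G x] lin[OF w] pow_mat.simps
      by (rule assoc_mult_mat_vec[OF pow_carrier_mat[OF K'(2)] K'(2) mult_mat_vec_carrier[OF K w]])
    also have "K' *\<^sub>v (K *\<^sub>v ?w) = ?w"
      using assoc_mult_mat_vec[OF K'(2) K w] w unfolding K'(3) by simp
    finally show ?case using Suc by simp
  qed
  then have "mat_neg_pow K (2 * l) *\<^sub>v v = x"
    unfolding mat_neg_pow_def K'(1) option.sel v[symmetric] G_def .
  then show ?thesis using B unfolding phi_def K_def G_def by simp
qed

section \<open>Quadrature from a Jacobi matrix\<close>

text \<open>Each multiplication by \<open>J\<close> extends the support of a vector by at most one
  index. Starting from the first axis vector, the entry at index \<open>degree p\<close> therefore
  collects exactly the subdiagonal entries passed on the way.\<close>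

lemma poly_op_hessenberg_coeff:
  fixes J :: "'a :: field mat"
  assumes J: "J \<in> carrier_mat r r"
    and hess: "\<And>i k. i < r \<Longrightarrow> k + 1 < i \<Longrightarrow> J $$ (i, k) = 0"
    and i: "i < r"
  shows "(degree p < i \<longrightarrow> poly_op J p (unit_vec r 0) $ i = 0) \<and>
     (degree p = i \<longrightarrow> poly_op J p (unit_vec r 0) $ i = lead_coeff p * (\<Prod>k<i. J $$ (Suc k, k)))"
  using i
proof (induction p arbitrary: i)
  case (pCons a p)
  let ?e = "unit_vec r 0" and ?w = "poly_op J p (unit_vec r 0)"
  have w: "?w \<in> carrier_vec r" using poly_op_carrier[OF J] by simp
  have entry: "poly_op J (pCons a p) ?e $ i = a * ?e $ i + (\<Sum>k<r. J $$ (i, k) * ?w $ k)"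
    using pCons.prems J w
    by (auto simp: poly_op_pCons[OF J] scalar_prod_def atLeast0LessThan carrier_vecD[OF w]
        intro!: sum.cong)
  show ?case
  proof (cases "p = 0")
    case True
    then have "poly_op J (pCons a p) ?e $ i = a * ?e $ i"
      using pCons.prems J by (simp add: poly_op_pCons[OF J] poly_op_0[OF J] mult_mat_zero_vec[OF J])
    then show ?thesis using True pCons.prems by auto
  next
    case False
    let ?d = "degree p"
    \<comment> \<open>Beyond \<open>?d\<close> the vector vanishes by induction, before it the
      matrix entry does; only \<open>k = ?d\<close> with \<open>i = Suc ?d\<close> can
      survive.\<close>
    have zero: "J $$ (i, k) * ?w $ k = 0" if "k < r" "Suc ?d \<le> i" "k \<noteq> ?d \<or> Suc ?d < i" for k
    proof (cases "k > ?d")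
      case True
      then show ?thesis using pCons.IH[of k] that by simp
    next
      case False
      then have "k + 1 < i" using that by auto
      then show ?thesis using hess[of i k] pCons.prems by simp
    qed
    have "poly_op J (pCons a p) ?e $ i = 0" if "Suc ?d < i"
      using entry zero that pCons.prems by simp
    moreover have "poly_op J (pCons a p) ?e $ i = lead_coeff p * (\<Prod>k<i. J $$ (Suc k, k))"
      if "Suc ?d = i"
    proof -
      have "(\<Sum>k<r. J $$ (i, k) * ?w $ k) = (\<Sum>k\<in>{?d}. J $$ (i, k) * ?w $ k)"
        using zero that pCons.prems by (intro sum.mono_neutral_right) auto
      then show ?thesis
        using entry pCons.IH[of ?d] that pCons.prems by (auto simp: mult_ac)
    qed
    ultimately show ?thesis using False by auto
  qed
qed (use poly_op_0[OF J] in auto)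

text \<open>An unreduced Hessenberg matrix \<open>B * B\<^sup>T\<close> is a Jacobi matrix with cyclic vector \<open>unit_vec r 0\<close>.\<close>

locale jacobi_gram =
  fixes B J :: "real mat" and r s :: nat
  assumes B: "B \<in> carrier_mat r s" and r: "r > 0"
    and J_def: "J = B * transpose_mat B"
    and hess: "\<And>i k. i < r \<Longrightarrow> k + 1 < i \<Longrightarrow> J $$ (i, k) = 0"
    and unreduced: "\<And>k. Suc k < r \<Longrightarrow> J $$ (Suc k, k) \<noteq> 0"
begin

abbreviation e where "e \<equiv> unit_vec r 0 :: real vec"

lemma J: "J \<in> carrier_mat r r"
  using B unfolding J_def by auto

lemma sym_J: "transpose_mat J = J"
  using B unfolding J_def by (subst transpose_mult[of _ r s _ r]) auto

lemma e: "e \<in> carrier_vec r" by simp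

lemma poly_J_carrier: "poly_op J p e \<in> carrier_vec r"
  by (rule poly_op_carrier[OF J e])

lemma poly_J_coeff_0: "degree p < i \<Longrightarrow> i < r \<Longrightarrow> poly_op J p e $ i = 0"
  using poly_op_hessenberg_coeff[OF J hess, of i p] by blast

lemma poly_J_coeff_degree:
  assumes "p \<noteq> 0" "degree p < r"
  shows "poly_op J p e $ degree p \<noteq> 0"
proof -
  have "(\<Prod>k<degree p. J $$ (Suc k, k)) \<noteq> 0"
    using unreduced assms(2) by auto
  moreover have "poly_op J p e $ degree p = lead_coeff p * (\<Prod>k<degree p. J $$ (Suc k, k))"
    using poly_op_hessenberg_coeff[OF J hess assms(2), of p] by blast
  ultimately show ?thesis using assms(1) by simp
qed

lemma poly_J_nonzero: "p \<noteq> 0 \<Longrightarrow> degree p < r \<Longrightarrow> poly_op J p e \<noteq> 0\<^sub>v r"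
  using poly_J_coeff_degree[of p] by auto

text \<open>Triangular elimination: a multiple of \<open>J^k e\<close> removes the entry at index
  \<open>k\<close>. Bounding coefficients instead of the degree lets \<open>k = 0\<close> force
  \<open>p = 0\<close>.\<close>

lemma cyclic:
  assumes "k \<le> r" "v \<in> carrier_vec r" "\<And>i. k \<le> i \<Longrightarrow> i < r \<Longrightarrow> v $ i = 0"
  shows "\<exists>p. (\<forall>i\<ge>k. coeff p i = 0) \<and> poly_op J p e = v"
  using assms
proof (induction k arbitrary: v)
  case 0
  then show ?case using poly_op_0[OF J e] by (intro exI[of _ 0]) (auto intro!: eq_vecI)
next
  case (Suc k)
  define m :: "real poly" where "m = monom 1 k"
  have m: "m \<noteq> 0" "degree m = k" by (simp_all add: m_def degree_monom_eq)
  define c where "c = v $ k / poly_op J m e $ k"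
  define u where "u = v - poly_op J (Polynomial.smult c m) e"
  have ne: "poly_op J m e $ k \<noteq> 0" using poly_J_coeff_degree[of m] m Suc.prems by simp
  note mc = poly_J_carrier[of m]
  have ui: "u $ i = v $ i - c * poly_op J m e $ i" if "i < r" for i
    using that mc Suc.prems(2) by (simp add: u_def poly_op_smult[OF J e])
  have "u $ i = 0" if "k \<le> i" "i < r" for i
  proof (cases "i = k")
    case True
    then show ?thesis using ui that ne by (simp add: c_def)
  next
    case False
    then show ?thesis using ui that Suc.prems(3)[of i] poly_J_coeff_0[of m i] m by simp
  qed
  moreover have "u \<in> carrier_vec r" using Suc.prems(2) poly_J_carrier by (simp add: u_def)
  ultimately obtain p where p: "\<forall>i\<ge>k. coeff p i = 0" "poly_op J p e = u"
    using Suc.IH[of u] Suc.prems(1) by auto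
  have "poly_op J (p + Polynomial.smult c m) e = v"
    using poly_J_carrier[of "Polynomial.smult c m"] Suc.prems(2)
    by (simp add: poly_op_add[OF J e] p(2)) (auto simp: u_def intro!: eq_vecI)
  moreover have "\<forall>i\<ge>Suc k. coeff (p + Polynomial.smult c m) i = 0"
    using p(1) by (simp add: m_def)
  ultimately show ?case by blast
qed

text \<open>By cyclicity \<open>J^r e\<close> is a combination of lower powers applied to
  \<open>e\<close>. The resulting monic polynomial is the characteristic polynomial of
  \<open>J\<close>.\<close>

lemma annihilator: "\<exists>P. lead_coeff P = 1 \<and> degree P = r \<and> poly_op J P e = 0\<^sub>v r"
proof -
  have "\<exists>p. (\<forall>i\<ge>r. coeff p i = 0) \<and> poly_op J p e = poly_op J (monom 1 r) e"
    using cyclic[of r "poly_op J (monom 1 r) e"] poly_J_carrier by simp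
  then obtain p where p: "\<forall>i\<ge>r. coeff p i = 0" "poly_op J p e = poly_op J (monom 1 r) e" by blast
  define P where "P = monom 1 r - p"
  have "degree P \<le> r" using p(1) by (intro degree_le) (simp add: P_def)
  moreover have cr: "coeff P r = 1" using p(1) by (simp add: P_def)
  ultimately have deg: "degree P = r" by (simp add: le_antisym le_degree)
  have "poly_op J P e = 0\<^sub>v r"
    using p(2) poly_J_carrier[of "monom 1 r"] by (simp add: P_def poly_op_diff[OF J e])
  with deg cr show ?thesis by (intro exI[of _ P]) simp
qed

lemma moment_mult: "e \<bullet> poly_op J (p * u) e = poly_op J p e \<bullet> poly_op J u e"
  by (simp only: poly_op_mult[OF J e] poly_op_symmetric[OF J sym_J e poly_J_carrier])

text \<open>For \<open>L p = e \<bullet> poly_op J p e\<close> the annihilator is orthogonal to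
  every polynomial, while \<open>L (p * p)\<close> is the squared norm of \<open>p(J) e\<close>,
  positive below degree \<open>r\<close>. Hence the annihilator has \<open>r\<close> distinct real
  zeros.\<close>

lemma nodes:
  "\<exists>t. inj_on t {..<r} \<and> (\<forall>i<r. t i \<ge> 0) \<and> poly_op J (\<Prod>i<r. [:- t i, 1:]) e = 0\<^sub>v r"
proof -
  obtain P where P: "lead_coeff P = 1" "degree P = r" "poly_op J P e = 0\<^sub>v r"
    using annihilator by blast
  have "\<exists>t. inj_on t {..<degree P} \<and> P = (\<Prod>i<degree P. [:- t i, 1:])"
  proof (rule orthogonal_poly_splits[where L = "\<lambda>p. e \<bullet> poly_op J p e"])
    show "e \<bullet> poly_op J (p + u) e = e \<bullet> poly_op J p e + e \<bullet> poly_op J u e" for p u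
      using poly_J_carrier by (simp add: poly_op_add[OF J e] scalar_prod_add_distrib[of _ r])
    show "e \<bullet> poly_op J (Polynomial.smult c p) e = c * (e \<bullet> poly_op J p e)" for c p
      using poly_J_carrier[of p] scalar_prod_smult_distrib[OF e poly_J_carrier]
      by (simp only: poly_op_smult[OF J e])
    show "e \<bullet> poly_op J (p * p) e > 0" if "p \<noteq> 0" "degree p < degree P" for p
      using that poly_J_nonzero[of p] scalar_prod_self_pos[OF poly_J_carrier]
      by (simp add: moment_mult P(2))
    show "e \<bullet> poly_op J (P * p) e = 0" for p
      using poly_J_carrier by (simp only: moment_mult P(3) scalar_prod_left_zero)
  qed (rule P(1))
  then obtain t where t: "inj_on t {..<r}" "P = (\<Prod>i<r. [:- t i, 1:])" using P(2) by auto
  have "t i \<ge> 0" if i: "i < r" for i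
  proof -
    \<comment> \<open>With the factor of \<open>t i\<close> left out, \<open>R(J) e\<close> is an
      eigenvector for \<open>t i\<close>; it is nonzero because \<open>R\<close> has degree
      \<open>r - 1\<close>. Its Rayleigh quotient is nonnegative, \<open>J\<close> being a Gram
      matrix.\<close>
    define R where "R = (\<Prod>j\<in>{..<r} - {i}. [:- t j, 1:])"
    define u where "u = poly_op J R e"
    have u: "u \<in> carrier_vec r" using poly_J_carrier by (simp add: u_def)
    have "degree R = r - 1" using i by (simp add: R_def)
    moreover have "R \<noteq> 0" by (simp add: R_def)
    ultimately have "u \<noteq> 0\<^sub>v r" using poly_J_nonzero[of R] r by (simp add: u_def)
    then have pos: "u \<bullet> u > 0" using scalar_prod_self_pos[OF u] by simp
    have "P = [:- t i, 1:] * R"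
      unfolding t(2) R_def using i by (intro prod.remove) auto
    then have "0\<^sub>v r = poly_op J [:- t i, 1:] u"
      using P(3) by (simp only: poly_op_mult[OF J e] u_def)
    also have "\<dots> = (- t i) \<cdot>\<^sub>v u + J *\<^sub>v u"
      using u J by (simp add: poly_op_pCons[OF J] poly_op_0[OF J] mult_mat_zero_vec[OF J])
    finally have "u \<bullet> 0\<^sub>v r = u \<bullet> ((- t i) \<cdot>\<^sub>v u + J *\<^sub>v u)" by simp
    also have "\<dots> = - t i * (u \<bullet> u) + u \<bullet> (J *\<^sub>v u)"
      using u J by (subst scalar_prod_add_distrib[of _ r]) auto
    finally have "t i * (u \<bullet> u) = u \<bullet> (J *\<^sub>v u)" using u by simp
    also have "\<dots> \<ge> 0"
      unfolding J_def scalar_prod_gram[OF B u u] by (rule scalar_prod_self_nonneg)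
    finally show ?thesis using pos by (simp add: zero_le_mult_iff)
  qed
  then show ?thesis using t P(3) by blast
qed

context
  fixes t :: "nat \<Rightarrow> real"
  assumes inj: "inj_on t {..<r}" and nonneg: "\<forall>i<r. t i \<ge> 0"
    and ann: "poly_op J (\<Prod>i<r. [:- t i, 1:]) e = 0\<^sub>v r"
begin

text \<open>A polynomial vanishing at all nodes is a multiple of the annihilator. Hence
  \<open>p(J) e\<close> depends only on the values of \<open>p\<close> at the nodes.\<close>

lemma poly_J_eq_0I:
  assumes "\<And>i. i < r \<Longrightarrow> poly p (t i) = 0"
  shows "poly_op J p e = 0\<^sub>v r"
proof -
  have "(\<Prod>i<r. [:- t i, 1:]) dvd p"
    using assms inj by (intro prod_linear_dvdI) auto
  then obtain u where "p = u * (\<Prod>i<r. [:- t i, 1:])" by (metis dvdE mult.commute)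
  then show ?thesis
    by (simp only: poly_op_mult[OF J e] ann poly_op_zero_vec[OF J])
qed

lemma annihilates:
  assumes "v \<in> carrier_vec r"
  shows "poly_op J (\<Prod>i<r. [:- t i, 1:]) v = 0\<^sub>v r"
proof -
  obtain p where p: "poly_op J p e = v" using cyclic[of r v] assms by auto
  have "poly_op J ((\<Prod>i<r. [:- t i, 1:]) * p) e = 0\<^sub>v r"
    by (rule poly_J_eq_0I) (auto simp: poly_prod)
  then show ?thesis by (simp only: poly_op_mult[OF J e] p)
qed

text \<open>Applied to a null vector of \<open>J\<close>, the annihilator keeps only its constant
  term, which must then be zero.\<close>

lemma zero_node:
  assumes z: "z \<in> carrier_vec r" "z \<noteq> 0\<^sub>v r" "transpose_mat B *\<^sub>v z = 0\<^sub>v s"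
  shows "\<exists>i<r. t i = 0"
proof -
  have Jz: "J *\<^sub>v z = 0\<^sub>v r" using B z(1,3) by (simp add: J_def)
  obtain c P' where P: "(\<Prod>i<r. [:- t i, 1:]) = pCons c P'" by (cases "\<Prod>i<r. [:- t i, 1:]")
  have "0\<^sub>v r = c \<cdot>\<^sub>v z + poly_op J P' (J *\<^sub>v z)"
    using annihilates[OF z(1)] z(1) by (simp add: P poly_op_pCons[OF J] poly_op_mult_mat_vec[OF J])
  then have "c \<cdot>\<^sub>v z = 0\<^sub>v r"
    using z(1) by (simp add: Jz poly_op_zero_vec[OF J])
  moreover obtain i where "i < r" "z $ i \<noteq> 0" 
    using z(1,2) by (metis carrier_vecD eq_vecI index_zero_vec)
  ultimately have "c = 0" using z(1) by (metis carrier_vecD index_smult_vec(1) index_zero_vec(1) mult_eq_0_iff)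
  then have "poly (\<Prod>i<r. [:- t i, 1:]) 0 = 0" by (simp only: P) simp
  then show ?thesis by (auto simp: poly_prod)
qed

lemma quadrature:
  "\<exists>w. (\<forall>p. e \<bullet> poly_op J p e = quad_rule r t w (poly p)) \<and>
     (\<forall>\<mu>\<ge>0. \<forall>l. phi B e l \<mu> = quad_rule r t w (\<lambda>x. 1 / (\<mu> * x + 1) ^ (2 * l)))"
proof -
  have "\<exists>b. \<forall>k<r. poly b (t k) = (if k = i then 1 else 0)" for i
    using lagrange_interpolation[OF finite_lessThan inj, of "\<lambda>k. if k = i then 1 else 0"] by blast
  then obtain b where b: "\<And>i k. k < r \<Longrightarrow> poly (b i) (t k) = (if k = i then 1 else 0)"
    by metis
  \<comment> \<open>The weights are the functional evaluated on the Lagrange basis. Since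
    \<open>p\<close> and its interpolant agree at the nodes, the rule is exact for the functional of
    \<open>J\<close> in every degree.\<close>
  define w where "w i = e \<bullet> poly_op J (b i) e" for i
  have quad: "e \<bullet> poly_op J p e = quad_rule r t w (poly p)" for p
  proof -
    define g where "g K = (\<Sum>i\<in>K. Polynomial.smult (poly p (t i)) (b i))" for K :: "nat set"
    have g: "e \<bullet> poly_op J (g K) e = (\<Sum>i\<in>K. w i * poly p (t i))" if "finite K" for K
      using that
    proof (induction K rule: finite_induct)
      case empty
      then show ?case by (simp add: g_def poly_op_0[OF J])
    next
      case (insert a K)
      have "g (insert a K) = Polynomial.smult (poly p (t a)) (b a) + g K"
        using insert.hyps by (simp add: g_def)
      then have "e \<bullet> poly_op J (g (insert a K)) e
          = poly p (t a) * (e \<bullet> poly_op J (b a) e) + e \<bullet> poly_op J (g K) e"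
        using poly_J_carrier
        by (simp only: poly_op_add[OF J e] poly_op_smult[OF J e] smult_carrier_vec
            scalar_prod_add_distrib[OF e] scalar_prod_smult_distrib[OF e])
      then show ?case using insert by (simp add: w_def mult.commute)
    qed
    have "poly (p - g {..<r}) (t k) = 0" if k: "k < r" for k
    proof -
      have "poly (g {..<r}) (t k) = (\<Sum>i<r. if k = i then poly p (t k) else 0)"
        unfolding g_def poly_sum using k by (intro sum.cong) (auto simp: b)
      then show ?thesis using k by simp
    qed
    then have "poly_op J (p - g {..<r}) e = 0\<^sub>v r" by (rule poly_J_eq_0I)
    then have "poly_op J p e = poly_op J (g {..<r}) e"
      unfolding poly_op_diff[OF J e] using poly_J_carrier[of p] poly_J_carrier[of "g {..<r}"]
      by (auto simp: vec_eq_iff)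
    then show ?thesis using g[of "{..<r}"] by (simp add: quad_rule_def)
  qed
  have "phi B e l \<mu> = quad_rule r t w (\<lambda>x. 1 / (\<mu> * x + 1) ^ (2 * l))" if \<mu>: "\<mu> \<ge> 0" for \<mu> l
  proof -
    \<comment> \<open>At the nodes \<open>h\<close> is the reciprocal of
      \<open>(\<mu> x + 1)^(2 l)\<close>, so \<open>h(J) e\<close> solves the system that defines
      \<open>phi\<close>.\<close>
    obtain h where h: "\<And>i. i < r \<Longrightarrow> poly h (t i) = 1 / (\<mu> * t i + 1) ^ (2 * l)"
      using lagrange_interpolation[OF _ inj, of "\<lambda>i. 1 / (\<mu> * t i + 1) ^ (2 * l)"] by auto
    have "poly ([:1, \<mu>:] ^ (2 * l) * h - 1) (t i) = 0" if "i < r" for i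
    proof -
      have "\<mu> * t i + 1 > 0" using \<mu> nonneg that by (simp add: add_nonneg_pos)
      then show ?thesis using h[OF that] by (simp add: poly_power add.commute mult.commute)
    qed
    then have "poly_op J ([:1, \<mu>:] ^ (2 * l) * h - 1) e = 0\<^sub>v r" by (rule poly_J_eq_0I)
    then have "poly_op J ([:1, \<mu>:] ^ (2 * l) * h) e = e"
      unfolding poly_op_diff[OF J e] poly_op_1[OF J e]
      using poly_J_carrier[of "[:1, \<mu>:] ^ (2 * l) * h"] by (auto simp: vec_eq_iff)
    then have "poly_op J ([:1, \<mu>:] ^ (2 * l)) (poly_op J h e) = e"
      by (simp only: poly_op_mult[OF J e])
    then have "phi B e l \<mu> = e \<bullet> poly_op J h e"
      unfolding J_def[symmetric] by (intro phi_eqI[OF B \<mu>]) (use poly_J_carrier in \<open>auto simp: J_def\<close>)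
    then show ?thesis using h by (simp add: quad quad_rule_def)
  qed
  with quad show ?thesis by blast
qed

end

end

section \<open>The spectral measure as a point measure\<close>

lemma continuous_at_right_step:
  "continuous (at_right a) (\<lambda>t :: real. if x \<le> t then c else (0 :: real))"
proof (cases "x \<le> a")
  case True
  have "\<forall>\<^sub>F t in at_right a. (if x \<le> t then c else 0) = (if x \<le> a then c else 0)"
    using eventually_at_right_less[of a] by eventually_elim (use True in auto)
  then show ?thesis unfolding continuous_within by (rule tendsto_eventually)
next
  case False
  then have "\<forall>\<^sub>F t in at_right a. t < x"
    by (intro order_tendstoD(2)[OF tendsto_ident_at]) auto
  then have "\<forall>\<^sub>F t in at_right a. (if x \<le> t then c else 0) = (if x \<le> a then c else 0)"
    by eventually_elim (use False in auto)
  then show ?thesis unfolding continuous_within by (rule tendsto_eventually)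
qed

text \<open>Both measures give the half-open interval from \<open>a\<close> to \<open>b\<close> the
  sum of the jumps in it, and such intervals form an intersection-stable generator. The pushforward
  adds up the jumps at coinciding \<open>lam j\<close>.\<close>

lemma interval_measure_step:
  fixes lam c :: "nat \<Rightarrow> real"
  assumes c: "\<And>j. j < m \<Longrightarrow> c j \<ge> 0"
  shows "interval_measure (\<lambda>t. \<Sum>j \<in> {j. j < m \<and> lam j \<le> t}. c j)
       = distr (point_measure {..<m} (\<lambda>j. ennreal (c j))) borel lam"
    (is "interval_measure ?F = ?D")
proof -
  have F: "?F t = (\<Sum>j<m. if lam j \<le> t then c j else 0)" for t
    by (subst sum.inter_filter[symmetric]) (auto intro!: sum.cong)
  have mono: "?F x \<le> ?F y" if "x \<le> y" for x y
    using that c by (intro sum_mono2) auto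
  have cont: "continuous (at_right a) ?F" for a
    unfolding F by (intro continuous_sum continuous_at_right_step)
  have meas: "lam \<in> measurable (point_measure {..<m} (\<lambda>j. ennreal (c j))) borel"
    by (simp add: measurable_point_measure_eq1)
  have D: "emeasure ?D {a<..b} = ennreal (?F b - ?F a)" if "a \<le> b" for a b
  proof -
    have "emeasure ?D {a<..b} = (\<Sum>j | j < m \<and> a < lam j \<and> lam j \<le> b. ennreal (c j))"
      using meas
      by (subst emeasure_distr)
         (auto simp: space_point_measure emeasure_point_measure_finite intro!: sum.cong)
    also have "\<dots> = ennreal (\<Sum>j | j < m \<and> a < lam j \<and> lam j \<le> b. c j)"
      using c by (intro sum_ennreal) auto
    also have "(\<Sum>j | j < m \<and> a < lam j \<and> lam j \<le> b. c j) = ?F b - ?F a"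
      using that by (subst sum_diff[symmetric]) (auto intro!: sum.cong)
    finally show ?thesis .
  qed
  show ?thesis
  proof (rule measure_eqI_generator_eq[where \<Omega> = UNIV and E = "range (\<lambda>(a, b). {a<..b})"
        and A = "\<lambda>i. {- real i<..real i}"])
    show "Int_stable (range (\<lambda>(a, b). {a<..b :: real}))"
      by (auto simp: Int_stable_def Int_greaterThanAtMost image_iff)
    show "emeasure (interval_measure ?F) X = emeasure ?D X"
      if "X \<in> range (\<lambda>(a, b). {a<..b})" for X
    proof -
      from that obtain a b where X: "X = {a<..b}" by auto
      show ?thesis
      proof (cases "a \<le> b")
        case True
        then show ?thesis unfolding X D[OF True] by (intro emeasure_interval_measure_Ioc mono cont)
      qed (simp add: X)
    qed
    show "(\<Union>i. {- real i<..real i}) = UNIV"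
    proof -
      have "\<exists>i. x \<in> {- real i<..real i}" for x :: real
        using reals_Archimedean2[of "\<bar>x\<bar>"] by (metis abs_less_iff greaterThanAtMost_iff less_imp_le minus_less_iff)
      then show ?thesis by blast
    qed
    show "emeasure (interval_measure ?F) {- real i<..real i} \<noteq> \<infinity>" for i
      using emeasure_interval_measure_Ioc[of "- real i" "real i" ?F, OF _ mono cont] by simp
  qed (auto simp: borel_sigma_sets_Ioc)
qed

text \<open>The measure is a finite sum of point masses, so integrability is automatic; as
  \<open>lam j \<ge> 0\<close>, the restriction to \<open>{0..}\<close> discards no mass, not even a
  jump at 0.\<close>

lemma spectral_integral:
  fixes f :: "real \<Rightarrow> real"
  assumes lam: "\<And>j. j < dim_vec b \<Longrightarrow> lam j \<ge> 0" and f: "f \<in> borel_measurable borel"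
  shows "set_integrable (spectral_measure W lam b) {0..} f"
    and "(LINT x:{0..}|spectral_measure W lam b. f x)
       = (\<Sum>j<dim_vec b. ((transpose_mat W *\<^sub>v b) $ j)\<^sup>2 * f (lam j))"
proof -
  let ?m = "dim_vec b" and ?c = "\<lambda>j. ((transpose_mat W *\<^sub>v b) $ j)\<^sup>2"
  let ?P = "point_measure {..<?m} (\<lambda>j. ennreal (?c j))"
  have M: "spectral_measure W lam b = distr ?P borel lam"
    unfolding spectral_measure_def spectral_distr_def[abs_def] by (rule interval_measure_step) simp
  have meas: "lam \<in> measurable ?P borel"
    by (simp add: measurable_point_measure_eq1)
  have g: "(\<lambda>x. indicator {0..} x *\<^sub>R f x) \<in> borel_measurable borel"
    using f by simp
  show "set_integrable (spectral_measure W lam b) {0..} f"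
    unfolding set_integrable_def M integrable_distr_eq[OF meas g]
    by (rule integrable_point_measure_finite) simp
  have "(LINT x:{0..}|spectral_measure W lam b. f x) = (LINT j|?P. indicator {0..} (lam j) *\<^sub>R f (lam j))"
    unfolding set_lebesgue_integral_def M by (rule integral_distr[OF meas g])
  also have "\<dots> = (\<Sum>j<?m. ?c j *\<^sub>R (indicator {0..} (lam j) *\<^sub>R f (lam j)))"
    by (rule lebesgue_integral_point_measure_finite) auto
  also have "\<dots> = (\<Sum>j<?m. ?c j * f (lam j))"
    using lam by (intro sum.cong) auto
  finally show "(LINT x:{0..}|spectral_measure W lam b. f x) = (\<Sum>j<?m. ?c j * f (lam j))" .
qed

section \<open>Orthonormal columns and spectral coordinates\<close>

lemma orthonormal_cols_gram:
  assumes "M \<in> carrier_mat n k" "orthonormal_cols M"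
  shows "transpose_mat M * M = 1\<^sub>m k"
  using assms by (intro eq_matI) (auto simp: orthonormal_cols_def)

lemma orthonormal_cols_scalar_prod:
  assumes M: "M \<in> carrier_mat n k" "orthonormal_cols M"
    and x: "x \<in> carrier_vec k" and y: "y \<in> carrier_vec k"
  shows "(M *\<^sub>v x) \<bullet> (M *\<^sub>v y) = x \<bullet> y"
proof -
  have "(M *\<^sub>v x) \<bullet> (M *\<^sub>v y) = (transpose_mat M *\<^sub>v (M *\<^sub>v x)) \<bullet> y"
    using M(1) x y by (intro scalar_prod_mult_mat_vec) auto
  also have "transpose_mat M *\<^sub>v (M *\<^sub>v x) = x"
    using assoc_mult_mat_vec[of "transpose_mat M" k n M k x] orthonormal_cols_gram[OF M] M(1) x
    by simp
  finally show ?thesis .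
qed

locale spectral =
  fixes A W :: "real mat" and lam :: "nat \<Rightarrow> real" and m n :: nat
  assumes A: "A \<in> carrier_mat m n" and fac: "spectral_factorization A W lam"
begin

abbreviation M where "M \<equiv> A * transpose_mat A"
abbreviation coord where "coord x \<equiv> transpose_mat W *\<^sub>v x"

lemma M: "M \<in> carrier_mat m m" using A by auto

lemma sym_M: "transpose_mat M = M"
  using A by (subst transpose_mult[of _ m n _ m]) auto

lemma W: "W \<in> carrier_mat m m" "orthonormal_cols W"
  using fac A unfolding spectral_factorization_def by auto

lemma lam_nonneg: "j < m \<Longrightarrow> lam j \<ge> 0"
  using fac A unfolding spectral_factorization_def by auto

lemma W_inverse: "transpose_mat W * W = 1\<^sub>m m" "W * transpose_mat W = 1\<^sub>m m"
  using orthonormal_cols_gram[OF W] mat_mult_left_right_inverse[of "transpose_mat W" m W] W(1)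
  by auto

lemma coord_W: "x \<in> carrier_vec m \<Longrightarrow> coord (W *\<^sub>v x) = x"
  using assoc_mult_mat_vec[of "transpose_mat W" m m W m x] W_inverse(1) W(1) by simp

lemma W_coord: "x \<in> carrier_vec m \<Longrightarrow> W *\<^sub>v coord x = x"
  using assoc_mult_mat_vec[of W m m "transpose_mat W" m x] W_inverse(2) W(1) by simp

lemma coord_carrier: "x \<in> carrier_vec m \<Longrightarrow> coord x \<in> carrier_vec m"
  using W(1) by auto

lemma coord_inject: "x \<in> carrier_vec m \<Longrightarrow> y \<in> carrier_vec m \<Longrightarrow> coord x = coord y \<Longrightarrow> x = y"
  using W_coord by metis

lemma coord_scalar_prod:
  assumes "x \<in> carrier_vec m" "y \<in> carrier_vec m"
  shows "x \<bullet> y = coord x \<bullet> coord y"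
  using orthonormal_cols_scalar_prod[OF W coord_carrier[OF assms(1)] coord_carrier[OF assms(2)]]
  by (simp only: W_coord[OF assms(1)] W_coord[OF assms(2)])

lemma coord_M:
  assumes x: "x \<in> carrier_vec m" and j: "j < m"
  shows "coord (M *\<^sub>v x) $ j = lam j * coord x $ j"
proof -
  have D: "mat_diag m lam \<in> carrier_mat m m" by simp
  have "M = W * mat_diag m lam * transpose_mat W"
    using fac A unfolding spectral_factorization_def by auto
  also have "\<dots> = W * (mat_diag m lam * transpose_mat W)"
    using W(1) D by (intro assoc_mult_mat[of _ m m _ m _ m]) auto
  finally have eq: "M = W * (mat_diag m lam * transpose_mat W)" .
  have DW: "mat_diag m lam * transpose_mat W \<in> carrier_mat m m"
    using W(1) by (intro mult_carrier_mat[OF D]) simp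
  have "M *\<^sub>v x = W *\<^sub>v ((mat_diag m lam * transpose_mat W) *\<^sub>v x)"
    unfolding eq by (rule assoc_mult_mat_vec[OF W(1) DW x])
  also have "(mat_diag m lam * transpose_mat W) *\<^sub>v x = mat_diag m lam *\<^sub>v coord x"
    by (rule assoc_mult_mat_vec[OF D _ x]) (use W(1) in simp)
  finally have "M *\<^sub>v x = W *\<^sub>v (mat_diag m lam *\<^sub>v coord x)" .
  then have "coord (M *\<^sub>v x) = mat_diag m lam *\<^sub>v coord x"
    using coord_W[of "mat_diag m lam *\<^sub>v coord x"] coord_carrier[OF x] D by simp
  then show ?thesis
    using j coord_carrier[OF x] W(1)
    by (simp add: mat_diag_def scalar_prod_def if_distrib[of "\<lambda>z. z * _"] cong: if_cong)
qed

lemma coord_poly_op: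
  assumes x: "x \<in> carrier_vec m" and j: "j < m"
  shows "coord (poly_op M p x) $ j = poly p (lam j) * coord x $ j"
proof (induction p)
  case 0
  then show ?case using x j W(1) by (simp add: poly_op_0[OF M] mult_mat_zero_vec[of _ m m])
next
  case (pCons a p)
  have px: "poly_op M p x \<in> carrier_vec m" by (rule poly_op_carrier[OF M x])
  have "coord (a \<cdot>\<^sub>v x + M *\<^sub>v poly_op M p x) = a \<cdot>\<^sub>v coord x + coord (M *\<^sub>v poly_op M p x)"
    using x px M W(1) by (simp add: mult_add_distrib_mat_vec[of _ m m] mult_mat_vec[of _ m m])
  then show ?case
    using pCons.IH j x W(1) coord_M[OF px j] M
    by (simp add: poly_op_pCons[OF M] algebra_simps del: index_mult_mat_vec)
qed

lemma moment:
  assumes x: "x \<in> carrier_vec m"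
  shows "x \<bullet> poly_op M p x = (\<Sum>j<m. (coord x $ j)\<^sup>2 * poly p (lam j))"
proof -
  have "x \<bullet> poly_op M p x = (\<Sum>j<m. coord x $ j * coord (poly_op M p x) $ j)"
    using W(1)
    by (subst coord_scalar_prod[OF x poly_op_carrier[OF M x]])
       (simp add: scalar_prod_def atLeast0LessThan del: index_mult_mat_vec)
  also have "\<dots> = (\<Sum>j<m. (coord x $ j)\<^sup>2 * poly p (lam j))"
    by (intro sum.cong) (simp_all add: coord_poly_op[OF x] power2_eq_square mult_ac del: index_mult_mat_vec)
  finally show ?thesis .
qed

text \<open>In eigenvector coordinates the shifted system is diagonal and is solved entrywise by
  \<open>y\<close>.\<close>

lemma phi_spectral:
  assumes b: "b \<in> carrier_vec m" and \<mu>: "\<mu> \<ge> 0"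
  shows "phi A b l \<mu> = (\<Sum>j<m. (coord b $ j)\<^sup>2 * (1 / (\<mu> * lam j + 1) ^ (2 * l)))"
proof -
  define y where "y = vec m (\<lambda>j. coord b $ j / (\<mu> * lam j + 1) ^ (2 * l))"
  have y: "y \<in> carrier_vec m" by (simp add: y_def)
  then have x: "W *\<^sub>v y \<in> carrier_vec m" using W(1) by auto
  have "poly_op M ([:1, \<mu>:] ^ (2 * l)) (W *\<^sub>v y) = b"
  proof (rule coord_inject[OF poly_op_carrier[OF M x] b], rule eq_vecI)
    fix j assume "j < dim_vec (coord b)"
    then have j: "j < m" using W(1) by simp
    then have "\<mu> * lam j + 1 > 0" using \<mu> lam_nonneg by (simp add: add_nonneg_pos)
    then show "coord (poly_op M ([:1, \<mu>:] ^ (2 * l)) (W *\<^sub>v y)) $ j = coord b $ j"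
      unfolding coord_poly_op[OF x j] coord_W[OF y]
      using j by (simp add: y_def poly_power add.commute mult.commute del: index_mult_mat_vec)
  qed (use W(1) in simp)
  then have "phi A b l \<mu> = b \<bullet> (W *\<^sub>v y)" by (rule phi_eqI[OF A \<mu> x])
  also have "\<dots> = coord b \<bullet> y" using coord_scalar_prod[OF b x] coord_W[OF y] by simp
  also have "\<dots> = (\<Sum>j<m. (coord b $ j)\<^sup>2 * (1 / (\<mu> * lam j + 1) ^ (2 * l)))"
    unfolding scalar_prod_def carrier_vecD[OF y] atLeast0LessThan
    by (intro sum.cong) (simp_all add: y_def power2_eq_square del: index_mult_mat_vec)
  finally show ?thesis .
qed

end

section \<open>Krylov spaces and Golub-Kahan bidiagonalization\<close>

context jacobi_gram
begin

context
  fixes M Q :: "real mat" and m :: nat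
  assumes M: "M \<in> carrier_mat m m" and sym_M: "transpose_mat M = M"
    and Q: "Q \<in> carrier_mat m r" "orthonormal_cols Q"
    and intertwine: "\<And>z. z \<in> carrier_vec r \<Longrightarrow> z $ (r - 1) = 0 \<Longrightarrow> M *\<^sub>v (Q *\<^sub>v z) = Q *\<^sub>v (J *\<^sub>v z)"
begin

lemma Qe: "Q *\<^sub>v e \<in> carrier_vec m"
  using Q(1) by auto

text \<open>Intertwining is available only for vectors with last coordinate 0. This holds for
  \<open>p(J) e\<close> as long as \<open>degree p < r - 1\<close>, so one further multiplication
  reaches degree \<open>r - 1\<close>.\<close>

lemma krylov_intertwine:
  "degree p < r \<Longrightarrow> poly_op M p (Q *\<^sub>v e) = Q *\<^sub>v poly_op J p e"
proof (induction p)
  case 0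
  then show ?case by (simp only: poly_op_0[OF M Qe] poly_op_0[OF J e] mult_mat_zero_vec[OF Q(1)])
next
  case (pCons a p)
  show ?case
  proof (cases "p = 0")
    case True
    have "poly_op M [:a:] (Q *\<^sub>v e) = a \<cdot>\<^sub>v (Q *\<^sub>v e)"
      using Qe by (simp add: poly_op_pCons[OF M] poly_op_0[OF M] mult_mat_zero_vec[OF M])
    also have "\<dots> = Q *\<^sub>v poly_op J [:a:] e"
      using mult_mat_vec[OF Q(1) e]
      by (simp add: poly_op_pCons[OF J] poly_op_0[OF J] mult_mat_zero_vec[OF J])
    finally show ?thesis using True by simp
  next
    case False
    then have "degree p < r - 1" using pCons.prems by simp
    then have "poly_op J p e $ (r - 1) = 0" using poly_J_coeff_0 r by simp
    then have "M *\<^sub>v (Q *\<^sub>v poly_op J p e) = Q *\<^sub>v (J *\<^sub>v poly_op J p e)"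
      by (rule intertwine[OF poly_J_carrier])
    moreover have "poly_op M p (Q *\<^sub>v e) = Q *\<^sub>v poly_op J p e"
      using pCons.IH pCons.prems False by simp
    moreover have "Q *\<^sub>v (a \<cdot>\<^sub>v e + J *\<^sub>v poly_op J p e)
        = a \<cdot>\<^sub>v (Q *\<^sub>v e) + Q *\<^sub>v (J *\<^sub>v poly_op J p e)"
      using Q(1) J poly_J_carrier[of p]
      by (simp add: mult_add_distrib_mat_vec[of _ m r] mult_mat_vec[of _ m r])
    ultimately show ?thesis
      by (simp add: poly_op_pCons[OF M Qe] poly_op_pCons[OF J e])
  qed
qed

lemma krylov_moment_mult:
  "(Q *\<^sub>v e) \<bullet> poly_op M (p * u) (Q *\<^sub>v e) = poly_op M p (Q *\<^sub>v e) \<bullet> poly_op M u (Q *\<^sub>v e)"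
  by (simp only: poly_op_mult[OF M Qe]
      poly_op_symmetric[OF M sym_M Qe poly_op_carrier[OF M Qe]])

text \<open>The monomial is split into two factors of degree at most \<open>r - 1\<close>, one on
  each side of the inner product; there \<open>M\<close> may be replaced by \<open>J\<close>, and
  \<open>Q\<close> preserves inner products.\<close>

lemma krylov_monom_moment:
  assumes "k \<le> 2 * (r - 1)"
  shows "(Q *\<^sub>v e) \<bullet> poly_op M (monom 1 k) (Q *\<^sub>v e) = e \<bullet> poly_op J (monom 1 k) e"
proof -
  define i where "i = min k (r - 1)"
  define j where "j = k - i"
  have ij: "k = i + j" "i < r" "j < r" using assms r by (auto simp: i_def j_def)
  have k: "monom 1 k = (monom 1 i * monom 1 j :: real poly)" by (simp add: ij(1) mult_monom)
  have "(Q *\<^sub>v e) \<bullet> poly_op M (monom 1 k) (Q *\<^sub>v e)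
      = (Q *\<^sub>v poly_op J (monom 1 i) e) \<bullet> (Q *\<^sub>v poly_op J (monom 1 j) e)"
    unfolding k krylov_moment_mult using ij by (simp add: krylov_intertwine degree_monom_eq)
  also have "\<dots> = e \<bullet> poly_op J (monom 1 k) e"
    unfolding k moment_mult by (rule orthonormal_cols_scalar_prod[OF Q poly_J_carrier poly_J_carrier])
  finally show ?thesis .
qed

lemma krylov_moments:
  assumes "degree p \<le> 2 * (r - 1)"
  shows "(Q *\<^sub>v e) \<bullet> poly_op M p (Q *\<^sub>v e) = e \<bullet> poly_op J p e"
  unfolding poly_moment[OF M Qe Qe assms] poly_moment[OF J e e assms]
  by (intro sum.cong) (simp_all add: krylov_monom_moment)

text \<open>If the quadratic form of \<open>M\<close> on the range of \<open>Q\<close> is that of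
  \<open>J\<close>, one more degree is gained: \<open>x^(2 r - 1)\<close> is split as
  \<open>x^(r - 1) * x * x^(r - 1)\<close>, and the middle factor is handled by
  \<open>compr\<close>.\<close>

lemma krylov_moments_compression:
  assumes compr: "\<And>z. z \<in> carrier_vec r \<Longrightarrow> (Q *\<^sub>v z) \<bullet> (M *\<^sub>v (Q *\<^sub>v z)) = z \<bullet> (J *\<^sub>v z)"
    and deg: "degree p \<le> 2 * r - 1"
  shows "(Q *\<^sub>v e) \<bullet> poly_op M p (Q *\<^sub>v e) = e \<bullet> poly_op J p e"
proof -
  have "(Q *\<^sub>v e) \<bullet> poly_op M (monom 1 k) (Q *\<^sub>v e) = e \<bullet> poly_op J (monom 1 k) e"
    if "k \<le> 2 * r - 1" for k
  proof (cases "k \<le> 2 * (r - 1)")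
    case False
    let ?u = "monom 1 (r - 1) :: real poly"
    let ?z = "poly_op J ?u e"
    have "k = (r - 1) + (1 + (r - 1))" using False that r by linarith
    then have k: "monom 1 k = ?u * ([:0, 1:] * ?u)"
      by (simp add: mult_monom flip: monom_Suc)
    have X: "poly_op N ([:0, 1:] * ?u) v = N *\<^sub>v poly_op N ?u v"
      if "N \<in> carrier_mat i i" "v \<in> carrier_vec i" for N :: "real mat" and v i
      using poly_op_carrier[OF that, of ?u] that
      by (simp add: poly_op_pCons[OF that(1)] zero_smult_vec[of _ i])
    have "(Q *\<^sub>v e) \<bullet> poly_op M (monom 1 k) (Q *\<^sub>v e) = (Q *\<^sub>v ?z) \<bullet> (M *\<^sub>v (Q *\<^sub>v ?z))"
      unfolding k krylov_moment_mult X[OF M Qe] using r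
      by (simp add: krylov_intertwine degree_monom_eq)
    also have "\<dots> = ?z \<bullet> (J *\<^sub>v ?z)" by (rule compr[OF poly_J_carrier])
    also have "\<dots> = e \<bullet> poly_op J (monom 1 k) e"
      unfolding k moment_mult X[OF J e] ..
    finally show ?thesis .
  qed (rule krylov_monom_moment)
  then show ?thesis
    unfolding poly_moment[OF M Qe Qe deg] poly_moment[OF J e e deg]
    by (intro sum.cong) simp_all
qed

end

end

text \<open>Rows of a lower bidiagonal matrix overlap only if they are equal or adjacent, and
  adjacent ones share a single column. The bound \<open>r \<le> q + 1\<close> covers both the square
  and the extended matrix.\<close>

lemma bidiagonal_jacobi_gram:
  fixes D :: "real mat"
  assumes D: "D \<in> carrier_mat r q" and r: "0 < r" "r \<le> q + 1"
    and zero: "\<And>i j. i < r \<Longrightarrow> j < q \<Longrightarrow> i \<noteq> j \<Longrightarrow> i \<noteq> j + 1 \<Longrightarrow> D $$ (i, j) = 0"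
    and diag: "\<And>j. j < q \<Longrightarrow> j < r \<Longrightarrow> D $$ (j, j) > 0"
    and sub: "\<And>j. j < q \<Longrightarrow> j + 1 < r \<Longrightarrow> D $$ (j + 1, j) > 0"
  shows "jacobi_gram D (D * transpose_mat D) r q"
proof
  have entry: "(D * transpose_mat D) $$ (i, k) = (\<Sum>j<q. D $$ (i, j) * D $$ (k, j))"
    if "i < r" "k < r" for i k
    using D that by (simp add: scalar_prod_def atLeast0LessThan)
  show "(D * transpose_mat D) $$ (i, k) = 0" if "i < r" "k + 1 < i" for i k
  proof -
    have "D $$ (i, j) * D $$ (k, j) = 0" if "j < q" for j
      using zero[of i j] zero[of k j] that \<open>i < r\<close> \<open>k + 1 < i\<close>
      by (cases "i = j \<or> i = j + 1") auto
    moreover have "k < r" using that by simp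
    ultimately show ?thesis using that(1) by (auto simp: entry intro!: sum.neutral)
  qed
  show "(D * transpose_mat D) $$ (Suc k, k) \<noteq> 0" if k: "Suc k < r" for k
  proof -
    have kq: "k < q" using k r by simp
    have "D $$ (Suc k, j) * D $$ (k, j) = 0" if "j < q" "j \<noteq> k" for j
      using zero[of "Suc k" j] zero[of k j] that k by (cases "Suc k = j") auto
    then have "(\<Sum>j<q. D $$ (Suc k, j) * D $$ (k, j)) = (\<Sum>j\<in>{k}. D $$ (Suc k, j) * D $$ (k, j))"
      using kq by (intro sum.mono_neutral_right) auto
    then show ?thesis using entry[of "Suc k" k] diag[OF kq] sub[OF kq] k by simp
  qed
qed (use D r in auto)

lemma mult_mat_vec_split_last:
  fixes D :: "'a :: comm_semiring_0 mat"
  assumes "D \<in> carrier_mat m (q + 1)" "z \<in> carrier_vec (q + 1)"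
  shows "D *\<^sub>v z = mat m q (\<lambda>(i, j). D $$ (i, j)) *\<^sub>v vec_first z q + z $ q \<cdot>\<^sub>v col D q"
  using assms by (intro eq_vecI) (auto simp: scalar_prod_def vec_first_def mult.commute)

text \<open>Turns positivity of a moment into strict positivity of the quadrature error, whose
  integrand carries the additional positive factor \<open>d\<close>.\<close>

lemma sum_weighted_pos:
  fixes g d :: "'b \<Rightarrow> real"
  assumes "finite S" "\<And>j. j \<in> S \<Longrightarrow> g j \<ge> 0" "\<And>j. j \<in> S \<Longrightarrow> d j > 0" "sum g S > 0"
  shows "(\<Sum>j\<in>S. g j * d j) > 0"
proof -
  obtain j where j: "j \<in> S" "g j > 0"
    using assms(4) by (metis not_less sum_nonpos)
  show ?thesis
    by (rule sum_pos2[OF assms(1) j(1)]) (use j assms in \<open>auto simp: less_imp_le\<close>)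
qed

section \<open>Consequences of the bidiagonalization relations\<close>

locale golub_kahan_bidiag = spectral A W lam m n
  for A W :: "real mat" and lam :: "nat \<Rightarrow> real" and m n :: nat +
  fixes b :: "real vec" and q :: nat and U V Cbar :: "real mat"
  assumes b: "b \<in> carrier_vec m" and b_nonzero: "b \<noteq> 0\<^sub>v m" and q: "q \<ge> 1"
    and gk: "golub_kahan A b q U V Cbar"
begin

abbreviation C where "C \<equiv> first_rows q Cbar"
abbreviation Uq where "Uq \<equiv> first_cols q U"
abbreviation \<beta> where "\<beta> \<equiv> norm2 b"

lemma carrier:
  "U \<in> carrier_mat m (q + 1)" "V \<in> carrier_mat n q" "Cbar \<in> carrier_mat (q + 1) q"
  "C \<in> carrier_mat q q" "Uq \<in> carrier_mat m q"
  using gk A by (auto simp: golub_kahan_def lower_bidiagonal_pos_def first_rows_def first_cols_def)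

lemma col_U: "col U j \<in> carrier_vec m"
  using carrier(1) by (intro carrier_vecI) simp

lemma orthonormal: "orthonormal_cols U" "orthonormal_cols V" "orthonormal_cols Uq"
proof -
  show *: "orthonormal_cols U" "orthonormal_cols V" using gk by (auto simp: golub_kahan_def)
  have "col Uq i = col U i" if "i < q" for i
    using that carrier by (intro eq_vecI) (auto simp: first_cols_def)
  then show "orthonormal_cols Uq"
    using * carrier(1) carrier(5) unfolding orthonormal_cols_def by auto
qed

lemma relations: "A * V = U * Cbar" "transpose_mat A * Uq = V * transpose_mat C"
  using gk by (auto simp: golub_kahan_def)

lemma Cbar_entries:
  "j < q \<Longrightarrow> Cbar $$ (j, j) > 0" "j < q \<Longrightarrow> Cbar $$ (j + 1, j) > 0"
  "i < q + 1 \<Longrightarrow> j < q \<Longrightarrow> i \<noteq> j \<Longrightarrow> i \<noteq> j + 1 \<Longrightarrow> Cbar $$ (i, j) = 0"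
  using gk by (auto simp: golub_kahan_def lower_bidiagonal_pos_def)

lemma C_entry: "i < q \<Longrightarrow> j < q \<Longrightarrow> C $$ (i, j) = Cbar $$ (i, j)"
  using carrier by (simp add: first_rows_def)

lemma norm2_pos: "\<beta> > 0"
  using scalar_prod_self_pos[OF b b_nonzero] by (simp add: norm2_def)

sublocale radau: jacobi_gram Cbar "Cbar * transpose_mat Cbar" "q + 1" q
  by (rule bidiagonal_jacobi_gram) (use carrier Cbar_entries in auto)

sublocale gauss: jacobi_gram C "C * transpose_mat C" q q
  by (rule bidiagonal_jacobi_gram) (use carrier C_entry Cbar_entries q in auto)

lemma col_U_0: "col U 0 = U *\<^sub>v unit_vec (q + 1) 0" "col U 0 = Uq *\<^sub>v unit_vec q 0"
proof -
  show "col U 0 = U *\<^sub>v unit_vec (q + 1) 0"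
    using carrier by (intro eq_vecI) auto
  show "col U 0 = Uq *\<^sub>v unit_vec q 0"
    using carrier q by (intro eq_vecI) (auto simp: first_cols_def)
qed

lemma b_eq: "b = \<beta> \<cdot>\<^sub>v col U 0"
proof -
  have "col U 0 = (1 / \<beta>) \<cdot>\<^sub>v b" using gk by (simp add: golub_kahan_def)
  then show ?thesis using norm2_pos by (simp add: smult_smult_assoc)
qed

lemma poly_b: "poly_op M p b = \<beta> \<cdot>\<^sub>v poly_op M p (col U 0)"
  by (subst b_eq) (rule poly_op_smult_vec[OF M col_U])

lemma moment_b: "b \<bullet> poly_op M p b = \<beta>\<^sup>2 * (col U 0 \<bullet> poly_op M p (col U 0))"
  unfolding poly_b using poly_op_carrier[OF M col_U[of 0], of p] col_U[of 0]
  by (subst (1) b_eq) (simp add: power2_eq_square)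

lemma U_split:
  assumes "z \<in> carrier_vec (q + 1)"
  shows "U *\<^sub>v z = Uq *\<^sub>v vec_first z q + z $ q \<cdot>\<^sub>v col U q"
  using mult_mat_vec_split_last[OF carrier(1) assms] carrier(1) by (simp add: first_cols_def)

lemma At_Uq:
  assumes "z \<in> carrier_vec q"
  shows "transpose_mat A *\<^sub>v (Uq *\<^sub>v z) = V *\<^sub>v (transpose_mat C *\<^sub>v z)"
  using assoc_mult_mat_vec[of "transpose_mat A" n m Uq q z]
    assoc_mult_mat_vec[of V n q "transpose_mat C" q z] carrier A assms relations(2) by simp

lemma A_V:
  assumes "z \<in> carrier_vec q"
  shows "A *\<^sub>v (V *\<^sub>v z) = U *\<^sub>v (Cbar *\<^sub>v z)"
  using assoc_mult_mat_vec[of A m n V q z]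
    assoc_mult_mat_vec[of U m "q + 1" Cbar q z] carrier A assms relations(1) by simp

lemma M_mult:
  assumes "z \<in> carrier_vec m"
  shows "M *\<^sub>v z = A *\<^sub>v (transpose_mat A *\<^sub>v z)"
  using assoc_mult_mat_vec[of A m n "transpose_mat A" m z] A assms by simp

lemma Cbar_transpose_first:
  assumes z: "z \<in> carrier_vec (q + 1)" "z $ q = 0"
  shows "transpose_mat Cbar *\<^sub>v z = transpose_mat C *\<^sub>v vec_first z q"
  using assms carrier
  by (intro eq_vecI) (auto simp: scalar_prod_def vec_first_def C_entry first_rows_def)

text \<open>A vanishing last coordinate keeps \<open>U *\<^sub>v z\<close> in the range of
  \<open>Uq\<close>, where the relation for the transpose of \<open>A\<close> applies; the relation
  for \<open>A\<close> then leads back to \<open>U\<close>.\<close>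

lemma radau_intertwine:
  assumes z: "z \<in> carrier_vec (q + 1)" "z $ (q + 1 - 1) = 0"
  shows "M *\<^sub>v (U *\<^sub>v z) = U *\<^sub>v ((Cbar * transpose_mat Cbar) *\<^sub>v z)"
proof -
  have f: "vec_first z q \<in> carrier_vec q" by simp
  have Uz: "U *\<^sub>v z = Uq *\<^sub>v vec_first z q"
    using U_split[OF z(1)] z(2) mult_mat_vec_carrier[OF carrier(5) f]
    by (simp add: zero_smult_vec[OF col_U])
  have "transpose_mat A *\<^sub>v (U *\<^sub>v z) = V *\<^sub>v (transpose_mat Cbar *\<^sub>v z)"
    unfolding Uz At_Uq[OF f] using Cbar_transpose_first[OF z(1)] z(2) by simp
  then have "M *\<^sub>v (U *\<^sub>v z) = U *\<^sub>v (Cbar *\<^sub>v (transpose_mat Cbar *\<^sub>v z))"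
    using A_V[of "transpose_mat Cbar *\<^sub>v z"] M_mult[of "U *\<^sub>v z"] carrier z by simp
  also have "Cbar *\<^sub>v (transpose_mat Cbar *\<^sub>v z) = (Cbar * transpose_mat Cbar) *\<^sub>v z"
    using assoc_mult_mat_vec[of Cbar "q + 1" q "transpose_mat Cbar" "q + 1" z] carrier z by simp
  finally show ?thesis .
qed

text \<open>The zero last coordinate survives multiplication by the upper bidiagonal
  \<open>transpose_mat C\<close>. Hence \<open>Cbar\<close> produces no component along the last
  column of \<open>U\<close>, and the result stays in the range of \<open>Uq\<close>.\<close>

lemma gauss_intertwine:
  assumes z: "z \<in> carrier_vec q" "z $ (q - 1) = 0"
  shows "M *\<^sub>v (Uq *\<^sub>v z) = Uq *\<^sub>v ((C * transpose_mat C) *\<^sub>v z)"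
proof -
  define x where "x = transpose_mat C *\<^sub>v z"
  have x: "x \<in> carrier_vec q" 
    unfolding x_def by (rule mult_mat_vec_carrier[of _ q q]) (use carrier(4) z in auto)
  have y: "Cbar *\<^sub>v x \<in> carrier_vec (q + 1)" using carrier x by simp
  have "C $$ (k, q - 1) * z $ k = 0" if "k < q" for k
    using Cbar_entries(3)[of k "q - 1"] C_entry[of k "q - 1"] z(2) that q
    by (cases "k = q - 1") auto
  then have xq: "x $ (q - 1) = 0"
    using carrier(4) z(1) q by (auto simp: x_def scalar_prod_def intro!: sum.neutral)
  have "Cbar $$ (q, j) * x $ j = 0" if "j < q" for j
    using Cbar_entries(3)[of q j] xq that q by (cases "j = q - 1") auto
  then have yq: "(Cbar *\<^sub>v x) $ q = 0" 
    using carrier(3) x by (auto simp: scalar_prod_def intro!: sum.neutral)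
  have yf: "vec_first (Cbar *\<^sub>v x) q = C *\<^sub>v x"
    using carrier x by (intro eq_vecI) (auto simp: vec_first_def scalar_prod_def first_rows_def)
  have "M *\<^sub>v (Uq *\<^sub>v z) = U *\<^sub>v (Cbar *\<^sub>v x)"
    using M_mult[of "Uq *\<^sub>v z"] At_Uq[OF z(1)] A_V[OF x] carrier z by (simp add: x_def)
  also have "\<dots> = Uq *\<^sub>v (C *\<^sub>v x)"
    unfolding U_split[OF y] yq yf 
    using mult_mat_vec_carrier[OF carrier(5) mult_mat_vec_carrier[OF carrier(4) x]]
    by (simp add: zero_smult_vec[OF col_U])
  also have "C *\<^sub>v x = (C * transpose_mat C) *\<^sub>v z"
    using assoc_mult_mat_vec[of C q q "transpose_mat C" q z] carrier z by (simp add: x_def)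
  finally show ?thesis .
qed

text \<open>Both sides are squared norms, of \<open>V *\<^sub>v x\<close> and of \<open>x\<close>
  with \<open>x = transpose_mat C *\<^sub>v z\<close>, and \<open>V\<close> has orthonormal
  columns.\<close>

lemma gauss_compression:
  assumes z: "z \<in> carrier_vec q"
  shows "(Uq *\<^sub>v z) \<bullet> (M *\<^sub>v (Uq *\<^sub>v z)) = z \<bullet> ((C * transpose_mat C) *\<^sub>v z)"
proof -
  have u: "Uq *\<^sub>v z \<in> carrier_vec m" and x: "transpose_mat C *\<^sub>v z \<in> carrier_vec q"
    using carrier z by auto
  show ?thesis
    unfolding scalar_prod_gram[OF A u u] scalar_prod_gram[OF carrier(4) z z] At_Uq[OF z]
    by (rule orthonormal_cols_scalar_prod[OF carrier(2) orthonormal(2) x x])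
qed

text \<open>With \<open>q + 1\<close> basis vectors the splitting argument already reaches degree
  \<open>2 * q\<close>.\<close>

lemma radau_moments:
  "degree p \<le> 2 * q \<Longrightarrow>
     b \<bullet> poly_op M p b = \<beta>\<^sup>2 * (radau.e \<bullet> poly_op (Cbar * transpose_mat Cbar) p radau.e)"
  using radau.krylov_moments[OF M sym_M carrier(1) orthonormal(1) radau_intertwine, of p]
  by (simp add: moment_b col_U_0(1))

text \<open>With only \<open>q\<close> basis vectors splitting stops at \<open>2 * q - 2\<close>;
  the compression identity supplies degree \<open>2 * q - 1\<close>.\<close>

lemma gauss_moments:
  "degree p \<le> 2 * q - 1 \<Longrightarrow>
     b \<bullet> poly_op M p b = \<beta>\<^sup>2 * (gauss.e \<bullet> poly_op (C * transpose_mat C) p gauss.e)"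
  using gauss.krylov_moments_compression[OF M sym_M carrier(5) orthonormal(3) gauss_intertwine
      gauss_compression, of p]
  by (simp add: moment_b col_U_0(2))

lemma poly_b_eq:
  assumes "degree p \<le> q"
  shows "poly_op M p b = \<beta> \<cdot>\<^sub>v (U *\<^sub>v poly_op (Cbar * transpose_mat Cbar) p radau.e)"
  using radau.krylov_intertwine[OF M sym_M carrier(1) orthonormal(1) radau_intertwine, of p] assms
  by (simp add: poly_b col_U_0(1))

text \<open>Degree \<open>2 * q\<close> is still matched by the Jacobi matrix of order
  \<open>q + 1\<close>, for which the moment is a squared norm and \<open>p(J) e\<close> is nonzero.
  So no nonzero polynomial of degree at most \<open>q\<close> vanishes on the whole support of the
  measure.\<close>

lemma square_moment_pos:
  assumes "p \<noteq> 0" "degree p \<le> q"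
  shows "b \<bullet> poly_op M (p * p) b > 0"
proof -
  have deg: "degree (p * p) \<le> 2 * q" using degree_mult_le[of p p] assms(2) by linarith
  have "poly_op (Cbar * transpose_mat Cbar) p radau.e \<noteq> 0\<^sub>v (q + 1)"
    using radau.poly_J_nonzero[of p] assms by simp
  then show ?thesis
    using scalar_prod_self_pos[OF radau.poly_J_carrier[of p]] norm2_pos
    unfolding radau_moments[OF deg] radau.moment_mult by simp
qed

text \<open>If \<open>A\<^sup>T p(A A\<^sup>T) b\<close> vanished for a \<open>p\<close> of degree \<open>q\<close>, then \<open>A\<^sup>T u\<close>, with \<open>u\<close> the last column
  of \<open>U\<close>, would lie in the range of \<open>V\<close>, and its coordinates there are forced by \<open>A * V = U * Cbar\<close>.\<close>

lemma shifted_square_moment_pos: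
  assumes nb: "no_breakdown A q U V Cbar" and p: "p \<noteq> 0" "degree p = q"
  shows "b \<bullet> poly_op M ([:0, 1:] * (p * p)) b > 0"
proof -
  define z where "z = poly_op (Cbar * transpose_mat Cbar) p radau.e"
  have z: "z \<in> carrier_vec (q + 1)" using radau.poly_J_carrier by (simp add: z_def)
  \<comment> \<open>Degree exactly \<open>q\<close> makes the last coordinate nonzero, so the
    vanishing relation below can be solved for \<open>a\<close>.\<close>
  have zq: "z $ q \<noteq> 0" using radau.poly_J_coeff_degree[of p] p by (simp add: z_def)
  note uq = col_U[of q]
  define a where "a = transpose_mat A *\<^sub>v col U q"
  have a: "a \<in> carrier_vec n" 
    unfolding a_def by (rule mult_mat_vec_carrier[of _ n m]) (use A uq in auto)
  define y where "y = transpose_mat C *\<^sub>v vec_first z q"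
  have y: "y \<in> carrier_vec q" 
    unfolding y_def by (rule mult_mat_vec_carrier[of _ q q]) (use carrier(4) in auto)
  have At: "transpose_mat A \<in> carrier_mat n m" using A by simp
  have pb: "poly_op M p b = \<beta> \<cdot>\<^sub>v (U *\<^sub>v z)" using poly_b_eq p by (simp add: z_def)
  have Uz: "U *\<^sub>v z \<in> carrier_vec m" using carrier z by simp
  have AUz: "transpose_mat A *\<^sub>v (U *\<^sub>v z) = V *\<^sub>v y + z $ q \<cdot>\<^sub>v a"
  proof -
    have "transpose_mat A *\<^sub>v (U *\<^sub>v z)
        = transpose_mat A *\<^sub>v (Uq *\<^sub>v vec_first z q) + z $ q \<cdot>\<^sub>v a"
      unfolding U_split[OF z] a_def using A carrier uq
      by (simp add: mult_add_distrib_mat_vec[of _ n m] mult_mat_vec[of _ n m])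
    then show ?thesis by (simp add: At_Uq y_def)
  qed
  have "transpose_mat A *\<^sub>v poly_op M p b \<noteq> 0\<^sub>v n"
  proof
    assume "transpose_mat A *\<^sub>v poly_op M p b = 0\<^sub>v n"
    then have 0: "\<beta> \<cdot>\<^sub>v (V *\<^sub>v y + z $ q \<cdot>\<^sub>v a) = 0\<^sub>v n"
      using mult_mat_vec[OF At Uz, of \<beta>] unfolding pb AUz by simp
    have "a = V *\<^sub>v ((- 1 / z $ q) \<cdot>\<^sub>v y)"
    proof (rule eq_vecI)
      fix i assume "i < dim_vec (V *\<^sub>v ((- 1 / z $ q) \<cdot>\<^sub>v y))"
      then have i: "i < n" using carrier by simp
      then have "(V *\<^sub>v y) $ i + z $ q * a $ i = 0"
        using arg_cong[OF 0, of "\<lambda>v. v $ i"] norm2_pos a carrier(2)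
        by (simp del: index_mult_mat_vec)
      then have "a $ i = (- 1 / z $ q) * (V *\<^sub>v y) $ i"
        using zq by (simp add: field_simps)
      then show "a $ i = (V *\<^sub>v ((- 1 / z $ q) \<cdot>\<^sub>v y)) $ i"
        using mult_mat_vec[OF carrier(2) y] i carrier by simp
    qed (use a carrier in simp)
    moreover have "(- 1 / z $ q) \<cdot>\<^sub>v y \<in> carrier_vec q" using y by simp
    ultimately obtain x where x: "x \<in> carrier_vec q" "a = V *\<^sub>v x" by blast
    \<comment> \<open>Orthonormality recovers the coordinates of \<open>a\<close>. Transposing
      \<open>A * V = U * Cbar\<close> identifies them with the last row of \<open>Cbar\<close>,
      whose only nonzero entry is at \<open>q - 1\<close>.\<close>
    have "x = transpose_mat V *\<^sub>v a"
      using assoc_mult_mat_vec[of "transpose_mat V" q n V q x] carrier x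
        orthonormal_cols_gram[OF carrier(2) orthonormal(2)] by simp
    also have "\<dots> = transpose_mat (A * V) *\<^sub>v col U q"
      using assoc_mult_mat_vec[of "transpose_mat V" q n "transpose_mat A" m "col U q"] A carrier uq
        transpose_mult[of A m n V q] by (simp add: a_def)
    also have "\<dots> = transpose_mat Cbar *\<^sub>v (transpose_mat U *\<^sub>v col U q)"
      using assoc_mult_mat_vec[of "transpose_mat Cbar" q "q + 1" "transpose_mat U" m "col U q"]
        carrier uq transpose_mult[of U m "q + 1" Cbar q] by (simp add: relations(1))
    also have "transpose_mat U *\<^sub>v col U q = unit_vec (q + 1) q"
      using carrier(1) orthonormal(1) by (intro eq_vecI) (auto simp: orthonormal_cols_def)
    also have "transpose_mat Cbar *\<^sub>v unit_vec (q + 1) q = Cbar $$ (q, q - 1) \<cdot>\<^sub>v unit_vec q (q - 1)"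
    proof (rule eq_vecI)
      fix j assume "j < dim_vec (Cbar $$ (q, q - 1) \<cdot>\<^sub>v unit_vec q (q - 1))"
      then have j: "j < q" by simp
      then show "(transpose_mat Cbar *\<^sub>v unit_vec (q + 1) q) $ j
          = (Cbar $$ (q, q - 1) \<cdot>\<^sub>v unit_vec q (q - 1)) $ j"
        using carrier(3) Cbar_entries(3)[of q j] by (cases "j = q - 1") auto
    qed (use carrier in simp)
    finally have "a = Cbar $$ (q, q - 1) \<cdot>\<^sub>v (V *\<^sub>v unit_vec q (q - 1))"
      using x(2) mult_mat_vec[OF carrier(2)] by simp
    also have "V *\<^sub>v unit_vec q (q - 1) = col V (q - 1)"
      using carrier(2) q by (intro eq_vecI) auto
    finally show False using nb by (simp add: no_breakdown_def a_def)
  qed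
  moreover have pc: "poly_op M p b \<in> carrier_vec m" by (rule poly_op_carrier[OF M b])
  ultimately have "poly_op M p b \<bullet> (M *\<^sub>v poly_op M p b) > 0"
    unfolding scalar_prod_gram[OF A pc pc]
    using scalar_prod_self_pos[OF mult_mat_vec_carrier[OF At pc]] by blast
  moreover have "poly_op M (p * ([:0, 1:] * p)) b = poly_op M p (M *\<^sub>v poly_op M p b)"
    unfolding poly_op_mult[OF M b]
    using pc M by (simp add: poly_op_pCons[OF M] poly_op_0[OF M] zero_smult_vec[of _ m]
        mult_mat_zero_vec[OF M])
  moreover have "b \<bullet> poly_op M p (M *\<^sub>v poly_op M p b) = poly_op M p b \<bullet> (M *\<^sub>v poly_op M p b)"
    by (rule poly_op_symmetric[OF M sym_M b mult_mat_vec_carrier[OF M pc]])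
  moreover have "[:0, 1:] * (p * p) = p * ([:0, 1:] * p)" by (simp only: mult.left_commute)
  ultimately show ?thesis by metis
qed

section \<open>Nodes and weights of the two rules\<close>

lemma gauss_nodes:
  "\<exists>t w. inj_on t {..<q} \<and> (\<forall>i<q. t i \<ge> 0) \<and>
     (\<forall>p. degree p \<le> 2 * q - 1 \<longrightarrow> b \<bullet> poly_op M p b = quad_rule q t w (poly p)) \<and>
     (\<forall>\<mu>\<ge>0. \<forall>l. phi_proj C b l \<mu> = quad_rule q t w (\<lambda>x. 1 / (\<mu> * x + 1) ^ (2 * l)))"
proof -
  obtain t where t: "inj_on t {..<q}" "\<forall>i<q. t i \<ge> 0"
      "poly_op (C * transpose_mat C) (\<Prod>i<q. [:- t i, 1:]) gauss.e = 0\<^sub>v q"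
    using gauss.nodes by blast
  obtain w where w: "\<And>p. gauss.e \<bullet> poly_op (C * transpose_mat C) p gauss.e = quad_rule q t w (poly p)"
      "\<And>\<mu> l. \<mu> \<ge> 0 \<Longrightarrow> phi C gauss.e l \<mu> = quad_rule q t w (\<lambda>x. 1 / (\<mu> * x + 1) ^ (2 * l))"
    using gauss.quadrature[OF t] by blast
  \<comment> \<open>The rule for the axis vector becomes the rule for \<open>b\<close> by absorbing
    the squared norm of \<open>b\<close> into the weights.\<close>
  have scale: "\<beta>\<^sup>2 * quad_rule q t w f = quad_rule q t (\<lambda>i. \<beta>\<^sup>2 * w i) f" for f
    by (simp add: quad_rule_def sum_distrib_left mult.assoc)
  have dim: "dim_row C = q" using carrier(4) by simp
  show ?thesis
    by (rule exI[of _ t], rule exI[of _ "\<lambda>i. \<beta>\<^sup>2 * w i"])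
      (use t(1,2) dim in \<open>auto simp only: gauss_moments phi_proj_def w scale\<close>)
qed

lemma radau_nodes:
  "\<exists>t w. inj_on t {..<q + 1} \<and> (\<forall>i<q + 1. t i \<ge> 0) \<and> (\<exists>i<q + 1. t i = 0) \<and>
     (\<forall>p. degree p \<le> 2 * q \<longrightarrow> b \<bullet> poly_op M p b = quad_rule (q + 1) t w (poly p)) \<and>
     (\<forall>\<mu>\<ge>0. \<forall>l. phi_proj Cbar b l \<mu> = quad_rule (q + 1) t w (\<lambda>x. 1 / (\<mu> * x + 1) ^ (2 * l)))"
proof -
  obtain t where t: "inj_on t {..<q + 1}" "\<forall>i<q + 1. t i \<ge> 0"
      "poly_op (Cbar * transpose_mat Cbar) (\<Prod>i<q + 1. [:- t i, 1:]) radau.e = 0\<^sub>v (q + 1)"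
    using radau.nodes by blast
  obtain w where w: "\<And>p. radau.e \<bullet> poly_op (Cbar * transpose_mat Cbar) p radau.e
        = quad_rule (q + 1) t w (poly p)"
      "\<And>\<mu> l. \<mu> \<ge> 0 \<Longrightarrow>
        phi Cbar radau.e l \<mu> = quad_rule (q + 1) t w (\<lambda>x. 1 / (\<mu> * x + 1) ^ (2 * l))"
    using radau.quadrature[OF t] by blast
  \<comment> \<open>A null vector of the wide matrix \<open>transpose_mat Cbar\<close>: each row
    couples two successive entries, so the vector follows recursively from first entry 1. It forces
    the node at the origin.\<close>
  define z where "z = vec (q + 1) (\<lambda>i. \<Prod>j<i. - Cbar $$ (j, j) / Cbar $$ (Suc j, j))"
  have "transpose_mat Cbar *\<^sub>v z = 0\<^sub>v q"
  proof (rule eq_vecI)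
    fix j assume "j < dim_vec (0\<^sub>v q :: real vec)"
    then have j: "j < q" by simp
    have "(transpose_mat Cbar *\<^sub>v z) $ j = (\<Sum>i<q + 1. Cbar $$ (i, j) * z $ i)"
      using carrier(3) j by (simp add: scalar_prod_def z_def atLeast0LessThan)
    also have "\<dots> = (\<Sum>i\<in>{j, Suc j}. Cbar $$ (i, j) * z $ i)"
      using j Cbar_entries(3)[of _ j] by (intro sum.mono_neutral_right) auto
    also have "\<dots> = 0"
      using j Cbar_entries(2)[OF j] by (simp add: z_def)
    finally show "(transpose_mat Cbar *\<^sub>v z) $ j = 0\<^sub>v q $ j" using j by simp
  qed (use carrier(3) in simp)
  moreover have "z $ 0 = 1" by (simp add: z_def)
  then have "z \<noteq> 0\<^sub>v (q + 1)" by auto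
  ultimately have zero: "\<exists>i<q + 1. t i = 0"
    by (intro radau.zero_node[OF t, of z]) (auto simp: z_def)
  have scale: "\<beta>\<^sup>2 * quad_rule (q + 1) t w f = quad_rule (q + 1) t (\<lambda>i. \<beta>\<^sup>2 * w i) f" for f
    by (simp add: quad_rule_def sum_distrib_left mult.assoc del: sum.lessThan_Suc)
  have dim: "dim_row Cbar = q + 1" using carrier(3) by simp
  show ?thesis
    by (rule exI[of _ t], rule exI[of _ "\<lambda>i. \<beta>\<^sup>2 * w i"])
      (use t(1,2) zero dim in \<open>auto simp only: radau_moments phi_proj_def w scale\<close>)
qed

section \<open>Exactness for the measure and the two inequalities\<close>

lemma exact_uptoI:
  assumes "\<And>p. degree p \<le> d \<Longrightarrow> b \<bullet> poly_op M p b = quad_rule k t w (poly p)"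
  shows "exact_upto (spectral_measure W lam b) d k t w"
  unfolding exact_upto_def
proof (intro allI impI conjI)
  fix p :: "real poly" assume p: "degree p \<le> d"
  have meas: "poly p \<in> borel_measurable borel"
    by (intro borel_measurable_continuous_onI continuous_intros)
  have lam: "lam j \<ge> 0" if "j < dim_vec b" for j using that b lam_nonneg by simp
  show "set_integrable (spectral_measure W lam b) {0..} (poly p)"
    by (rule spectral_integral(1)[OF lam meas])
  show "(LINT x:{0..}|spectral_measure W lam b. poly p x) = quad_rule k t w (poly p)"
    using spectral_integral(2)[where W = W and b = b and lam = lam, OF lam meas] assms[OF p] moment[OF b, of p] b
    by (simp del: index_mult_mat_vec)
qed

lemma phi_integral:
  assumes \<mu>: "\<mu> \<ge> 0"
  shows "set_integrable (spectral_measure W lam b) {0..} (\<lambda>t. 1 / (\<mu> * t + 1) ^ (2 * l))"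
    and "phi A b l \<mu> = (LINT t:{0..}|spectral_measure W lam b. 1 / (\<mu> * t + 1) ^ (2 * l))"
proof -
  have meas: "(\<lambda>t. 1 / (\<mu> * t + 1) ^ (2 * l)) \<in> borel_measurable borel" by measurable
  have lam: "lam j \<ge> 0" if "j < dim_vec b" for j using that b lam_nonneg by simp
  show "set_integrable (spectral_measure W lam b) {0..} (\<lambda>t. 1 / (\<mu> * t + 1) ^ (2 * l))"
    by (rule spectral_integral(1)[OF lam meas])
  show "phi A b l \<mu> = (LINT t:{0..}|spectral_measure W lam b. 1 / (\<mu> * t + 1) ^ (2 * l))"
    using spectral_integral(2)[where W = W and b = b and lam = lam, OF lam meas] phi_spectral[OF b \<mu>] b
    by (simp del: index_mult_mat_vec)
qed

lemma phi_minus_moment: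
  assumes "\<mu> \<ge> 0"
  shows "phi A b l \<mu> - b \<bullet> poly_op M h b
    = (\<Sum>j<m. (coord b $ j)\<^sup>2 * (1 / (\<mu> * lam j + 1) ^ (2 * l) - poly h (lam j)))"
  unfolding phi_spectral[OF b assms] moment[OF b] right_diff_distrib sum_subtractf ..

text \<open>The interpolant \<open>h\<close> has the integrand's values at the nodes and is
  integrated exactly, so the gap equals the integral of the interpolation error, the squared nodal
  polynomial times a positive function. Its degree \<open>q\<close> prevents it from vanishing on
  the whole support.\<close>

lemma gauss_lower_bound:
  assumes \<mu>: "\<mu> > 0" and l: "l \<ge> 1"
  shows "phi_proj C b l \<mu> < phi A b l \<mu>"
proof -
  obtain t w where t: "\<And>i. i < q \<Longrightarrow> t i \<ge> 0"
    and exact: "\<And>p. degree p \<le> 2 * q - 1 \<Longrightarrow> b \<bullet> poly_op M p b = quad_rule q t w (poly p)"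
    and rule: "phi_proj C b l \<mu> = quad_rule q t w (\<lambda>x. 1 / (\<mu> * x + 1) ^ (2 * l))"
    using gauss_nodes \<mu> by (metis less_imp_le)
  obtain h d where h: "degree h \<le> 2 * q - 1"
    and d: "\<And>x. x \<ge> 0 \<Longrightarrow> d x > 0 \<and>
      1 / (\<mu> * x + 1) ^ (2 * l) - poly h x = (\<Prod>i<q. x - t i)\<^sup>2 * d x"
    using gauss_error[OF \<mu>, of "2 * l" q t] t l by auto
  define R where "R = (\<Prod>i<q. [:- t i, 1:])"
  have "poly h (t i) = 1 / (\<mu> * t i + 1) ^ (2 * l)" if "i < q" for i
  proof -
    \<comment> \<open>At a node the error formula vanishes, so \<open>h\<close> interpolates
      there.\<close>
    have "(\<Prod>k<q. t i - t k) = 0" using that by (intro prod_zero) auto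
    from d[OF t[OF that], unfolded this] show ?thesis by simp
  qed
  then have "phi_proj C b l \<mu> = b \<bullet> poly_op M h b"
    unfolding rule exact[OF h] quad_rule_def by simp
  then have "phi A b l \<mu> - phi_proj C b l \<mu>
      = (\<Sum>j<m. (coord b $ j)\<^sup>2 * (poly R (lam j))\<^sup>2 * d (lam j))"
    using \<mu> d lam_nonneg
    by (simp add: phi_minus_moment R_def mult.assoc del: index_mult_mat_vec)
  also have "\<dots> > 0"
  proof (rule sum_weighted_pos)
    have "R \<noteq> 0" "degree R \<le> q" by (simp_all add: R_def)
    then show "(\<Sum>j<m. (coord b $ j)\<^sup>2 * (poly R (lam j))\<^sup>2) > 0"
      using square_moment_pos[of R] by (simp add: moment[OF b] power2_eq_square)
  qed (use d lam_nonneg in auto)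
  finally show ?thesis by simp
qed

text \<open>The error is now \<open>x\<close> times a square times a positive function, which gives
  the weak bound at once. Strictness asks for support off the zeros of \<open>x * R^2\<close>, which
  the absence of breakdown guarantees.\<close>

lemma radau_upper_bound:
  assumes \<mu>: "\<mu> > 0" and l: "l \<ge> 1"
  shows "phi A b l \<mu> \<le> phi_proj Cbar b l \<mu>"
    and "no_breakdown A q U V Cbar \<Longrightarrow> phi A b l \<mu> < phi_proj Cbar b l \<mu>"
proof -
  obtain t w i0 where t: "\<And>i. i < q + 1 \<Longrightarrow> t i \<ge> 0" and i0: "i0 < q + 1" "t i0 = 0"
    and exact: "\<And>p. degree p \<le> 2 * q \<Longrightarrow> b \<bullet> poly_op M p b = quad_rule (q + 1) t w (poly p)"
    and rule: "phi_proj Cbar b l \<mu> = quad_rule (q + 1) t w (\<lambda>x. 1 / (\<mu> * x + 1) ^ (2 * l))"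
    using radau_nodes \<mu> by (metis less_imp_le)
  \<comment> \<open>The node at the origin is set aside and the other \<open>q\<close> nodes are
    renumbered by \<open>s\<close>, because the error formula treats 0 as a simple point and the
    rest as double ones.\<close>
  have "card ({..<q + 1} - {i0}) = q" using i0 by simp
  then obtain s where s: "bij_betw s {..<q} ({..<q + 1} - {i0})"
    using ex_bij_betw_nat_finite[of "{..<q + 1} - {i0}"] by (auto simp: atLeast0LessThan)
  have ts: "t (s i) \<ge> 0" if "i < q" for i
    using bij_betwE[OF s] that t by auto
  obtain h d where h: "degree h \<le> 2 * q"
    and d: "\<And>x. x \<ge> 0 \<Longrightarrow> d x > 0 \<and>
      poly h x - 1 / (\<mu> * x + 1) ^ (2 * l) = x * (\<Prod>i<q. x - t (s i))\<^sup>2 * d x"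
    using radau_error[OF \<mu>, of "2 * l" q "\<lambda>i. t (s i)"] ts l by auto
  define R where "R = (\<Prod>i<q. [:- t (s i), 1:])"
  have "poly h (t i) = 1 / (\<mu> * t i + 1) ^ (2 * l)" if i: "i < q + 1" for i
  proof (cases "i = i0")
    case True
    then show ?thesis using d[OF t[OF i]] i0 by simp
  next
    case False
    then have "i \<in> s ` {..<q}" using i bij_betw_imp_surj_on[OF s] by simp
    then obtain k where "k < q" "s k = i" by auto
    then have "(\<Prod>k<q. t i - t (s k)) = 0" by (intro prod_zero) auto
    from d[OF t[OF i], unfolded this] show ?thesis by simp
  qed
  then have "phi_proj Cbar b l \<mu> = b \<bullet> poly_op M h b"
    unfolding rule exact[OF h] quad_rule_def by simp
  then have "phi_proj Cbar b l \<mu> - phi A b l \<mu>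
      = - (\<Sum>j<m. (coord b $ j)\<^sup>2 * (1 / (\<mu> * lam j + 1) ^ (2 * l) - poly h (lam j)))"
    using \<mu> phi_minus_moment[of \<mu> l h] by simp
  also have "\<dots> = (\<Sum>j<m. (coord b $ j)\<^sup>2 * (poly h (lam j) - 1 / (\<mu> * lam j + 1) ^ (2 * l)))"
    unfolding sum_negf[symmetric] by (intro sum.cong) (simp_all add: algebra_simps)
  also have "\<dots> = (\<Sum>j<m. (coord b $ j)\<^sup>2 * (lam j * (poly R (lam j))\<^sup>2) * d (lam j))"
    using d lam_nonneg by (simp add: R_def mult.assoc del: index_mult_mat_vec)
  finally have diff: "phi_proj Cbar b l \<mu> - phi A b l \<mu> = \<dots>" .
  have "\<dots> \<ge> 0" using d lam_nonneg by (intro sum_nonneg) (auto simp: less_imp_le)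
  then show "phi A b l \<mu> \<le> phi_proj Cbar b l \<mu>" using diff by linarith
  assume nb: "no_breakdown A q U V Cbar"
  have "(\<Sum>j<m. (coord b $ j)\<^sup>2 * (lam j * (poly R (lam j))\<^sup>2) * d (lam j)) > 0"
  proof (rule sum_weighted_pos)
    have "R \<noteq> 0" "degree R = q" by (simp_all add: R_def)
    then show "(\<Sum>j<m. (coord b $ j)\<^sup>2 * (lam j * (poly R (lam j))\<^sup>2)) > 0"
      using shifted_square_moment_pos[OF nb, of R]
      by (simp add: moment[OF b] power2_eq_square del: index_mult_mat_vec)
  qed (use d lam_nonneg in auto)
  then show "phi A b l \<mu> < phi_proj Cbar b l \<mu>" using diff by linarith
qed

end

theorem theorem6:
  fixes A U V Cbar W :: "real mat" and b :: "real vec" and lam :: "nat \<Rightarrow> real"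
    and m n q l :: nat
  assumes "A \<in> carrier_mat m n" and "b \<in> carrier_vec m" and "b \<noteq> 0\<^sub>v m"
    and "l \<ge> 1" and "q \<ge> 1"
    and "golub_kahan A b q U V Cbar"
    and "spectral_factorization A W lam"
  shows
    "(\<forall>\<mu>\<ge>0. set_integrable (spectral_measure W lam b) {0..} (\<lambda>t. 1 / (\<mu> * t + 1) ^ (2 * l)) \<and>
        phi A b l \<mu> = (LINT t:{0..}|spectral_measure W lam b. 1 / (\<mu> * t + 1) ^ (2 * l))) \<and>
     (\<exists>t w. gauss_rule (spectral_measure W lam b) q t w \<and>
        (\<forall>\<mu>\<ge>0. phi_proj (first_rows q Cbar) b l \<mu> =
           quad_rule q t w (\<lambda>x. 1 / (\<mu> * x + 1) ^ (2 * l)))) \<and>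
     (\<exists>t w. gauss_radau_rule (spectral_measure W lam b) q t w \<and>
        (\<forall>\<mu>\<ge>0. phi_proj Cbar b l \<mu> =
           quad_rule (q + 1) t w (\<lambda>x. 1 / (\<mu> * x + 1) ^ (2 * l)))) \<and>
     (\<forall>\<mu>>0. phi_proj (first_rows q Cbar) b l \<mu> < phi A b l \<mu> \<and>
        phi A b l \<mu> \<le> phi_proj Cbar b l \<mu> \<and>
        (no_breakdown A q U V Cbar \<longrightarrow> phi A b l \<mu> < phi_proj Cbar b l \<mu>))"
proof -
  interpret golub_kahan_bidiag A W lam m n b q U V Cbar
    by unfold_locales (use assms in auto)
  have "\<exists>t w. gauss_rule (spectral_measure W lam b) q t w \<and>
        (\<forall>\<mu>\<ge>0. phi_proj (first_rows q Cbar) b l \<mu> =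
           quad_rule q t w (\<lambda>x. 1 / (\<mu> * x + 1) ^ (2 * l)))"
    using gauss_nodes exact_uptoI unfolding gauss_rule_def by metis
  moreover have "\<exists>t w. gauss_radau_rule (spectral_measure W lam b) q t w \<and>
        (\<forall>\<mu>\<ge>0. phi_proj Cbar b l \<mu> =
           quad_rule (q + 1) t w (\<lambda>x. 1 / (\<mu> * x + 1) ^ (2 * l)))"
    using radau_nodes exact_uptoI unfolding gauss_radau_rule_def by metis
  ultimately show ?thesis
    using phi_integral gauss_lower_bound radau_upper_bound assms(4) by auto
qed

end
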